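(* Polygraphic programs form a Turing-complete model of computation: for every Turing machine $\mathcal{M}$ computing a function $f$ on words over a finite alphabet $\Sigma$, there is a polygraphic program $\mathcal{P}$ together with a $2$-path $f$ that computes $f$ (words being represented as values of $\mathcal{P}$).
   Context: A monoidal $3$-polygraph $\mathcal{P}$ consists of: a set of $1$-cells (sorts); $1$-paths, which are finite words of $1$-cells, with concatenation written $\star_0$ and empty word $\ast$; a set of $2$-cells $\phi: s_1(\phi)\Rightarrow t_1(\phi)$ between $1$-paths (the length of $s_1(\phi)$ is the number of inputs, the length of $t_1(\phi)$ the number of outputs); $2$-paths, which are the morphisms of the free strict monoidal category generated by the $1$-cells and $2$-cells (circuits/string diagrams, considered modulo topological deformation), with sequential composition $f\star_1 g$ (defined when $t_1(f)=s_1(g)$) and parallel composition $f\star_0 g$; and a set of $3$-cells $\alpha: s_2(\alpha)\Rrightarrow t_2(\alpha)$ between $2$-paths having the same $1$-source and $1$-target. A rewriting step (elementary $3$-path) replaces an occurrence of $s_2(\alpha)$ inside a $2$-path (i.e. in a context $h\star_1(x\star_0 s_2(\alpha)\star_0 y)\star_1 k$) by $t_2(\alpha)$; $3$-paths are finite sequences of rewriting steps. Normal forms, termination and confluence are defined as for rewriting systems, with $2$-paths in place of terms. A polygraphic program is a monoidal $3$-polygraph whose $2$-cells are divided into: structure $2$-cells, namely one $\tau_{\xi,\zeta}:\xi\star_0\zeta\Rightarrow\zeta\star_0\xi$ for each pair of $1$-cells and one $\delta_\xi:\xi\Rightarrow\xi\star_0\xi$ and $\varepsilon_\xi:\xi\Rightarrow\ast$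 for each $1$-cell $\xi$; constructors, which are $2$-cells whose $1$-target is a single $1$-cell; and functions (arbitrary $2$-cells). Its $3$-cells are divided into structure $3$-cells, which for every constructor $\gamma:x\Rightarrow\xi$ and every $1$-cell $\zeta$ let $\gamma$ commute with permutation, duplication and erasure: $(\gamma\star_0\zeta)\star_1\tau_{\xi,\zeta}\Rrightarrow\tau_{x,\zeta}\star_1(\zeta\star_0\gamma)$, $(\zeta\star_0\gamma)\star_1\tau_{\zeta,\xi}\Rrightarrow\tau_{\zeta,x}\star_1(\gamma\star_0\zeta)$, $\gamma\star_1\delta_\xi\Rrightarrow\delta_x\star_1(\gamma\star_0\gamma)$, $\gamma\star_1\varepsilon_\xi\Rrightarrow\varepsilon_x$ (where $\tau,\delta,\varepsilon$ are extended to $1$-paths by the usual structural induction); and computation $3$-cells, whose $2$-source has the form $t\star_1\phi$ with $\phi$ a function and $t$ a $2$-path built only from $1$-cells and constructors. There is a finite constant bounding the number of structure $2$-cells in the $2$-target of each computation $3$-cell, and the result of applying a single $3$-cell to a $2$-path is computable in polynomial time. Semantics: a value of type $\xi$ is a $2$-path built only from constructors with no input and with $1$-target $\xi$; $\mathcal{V}(\xi)$ is the set of such values. A function $f:\mathcal{V}(\xi_1)\times\cdots\times\mathcal{V}(\xi_m)\to\mathcal{V}(\zeta_1)\times\cdots\times\mathcal{V}(\zeta_n)$ is computed by a confluent $\mathcal{P}$ if there is a $2$-path $f:\xi_1\star_0\cdots\star_0\xi_m\Rightarrow\zeta_1\star_0\cdots\star_0\zeta_n$ such that for all values $(t_1,\dots,t_m)$,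 $(t_1\star_0\cdots\star_0 t_m)\star_1 f$ normalizes into the family of values $f(t_1,\dots,t_m)$; if $\mathcal{P}$ is not confluent, $f(t_1,\dots,t_m)$ is required to be the maximum, for the lexicographic order, of the normal forms of $(t_1\star_0\cdots\star_0 t_m)\star_1 f$. *)

theory Defs
  imports
    "HOL-Library.Confluence"
    "HOL-Computational_Algebra.Polynomial"
begin

section \<open>Monoidal 3-polygraphs\<close>

text \<open>
  Expressions for 2-paths. The word \<open>u\<close> seen as a 2-path, i.e. its identity, is \<open>Path u\<close>.
\<close>

datatype ('s, 'c) expr =
    Path "'s list"
  | Cell 'c
  | Comp0 "('s, 'c) expr" "('s, 'c) expr"  (infixr \<open>\<star>\<^sub>0\<close> 72)
  | Comp1 "('s, 'c) expr" "('s, 'c) expr"  (infixr \<open>\<star>\<^sub>1\<close> 70)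

primrec cells_of :: "('s, 'c) expr \<Rightarrow> 'c list" where
  "cells_of (Path u) = []"
| "cells_of (Cell c) = [c]"
| "cells_of (a \<star>\<^sub>0 b) = cells_of a @ cells_of b"
| "cells_of (a \<star>\<^sub>1 b) = cells_of a @ cells_of b"

record ('s, 'c, 'r) polygraph =
  cells1 :: "'s set"
  cells2 :: "'c set"
  src1 :: "'c \<Rightarrow> 's list"
  tgt1 :: "'c \<Rightarrow> 's list"
  cells3 :: "'r set"
  src2 :: "'r \<Rightarrow> ('s, 'c) expr"
  tgt2 :: "'r \<Rightarrow> ('s, 'c) expr"

inductive has_type ::
  "('s, 'c, 'r) polygraph \<Rightarrow> ('s, 'c) expr \<Rightarrow> 's list \<Rightarrow> 's list \<Rightarrow> bool" for G where
  "set u \<subseteq> cells1 G \<Longrightarrow> has_type G (Path u) u u"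
| "c \<in> cells2 G \<Longrightarrow> has_type G (Cell c) (src1 G c) (tgt1 G c)"
| "has_type G a u v \<Longrightarrow> has_type G b u' v' \<Longrightarrow> has_type G (a \<star>\<^sub>0 b) (u @ u') (v @ v')"
| "has_type G a u v \<Longrightarrow> has_type G b v w \<Longrightarrow> has_type G (a \<star>\<^sub>1 b) u w"

text \<open>
  The congruence on well-typed expressions generated by the axioms of strict monoidal
  categories; its classes are the morphisms of the free strict monoidal category.
\<close>

inductive same_path ::
  "('s, 'c, 'r) polygraph \<Rightarrow> ('s, 'c) expr \<Rightarrow> ('s, 'c) expr \<Rightarrow> bool" for G where
  refl: "has_type G a u v \<Longrightarrow> same_path G a a"
| sym: "same_path G a b \<Longrightarrow> same_path G b a"
| trans: "same_path G a b \<Longrightarrow> same_path G b c \<Longrightarrow> same_path G a c"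
| cong0: "same_path G a a' \<Longrightarrow> same_path G b b' \<Longrightarrow> same_path G (a \<star>\<^sub>0 b) (a' \<star>\<^sub>0 b')"
| cong1: "same_path G a a' \<Longrightarrow> same_path G b b' \<Longrightarrow> has_type G (a \<star>\<^sub>1 b) u v
    \<Longrightarrow> same_path G (a \<star>\<^sub>1 b) (a' \<star>\<^sub>1 b')"
| assoc1: "has_type G ((a \<star>\<^sub>1 b) \<star>\<^sub>1 c) u v \<Longrightarrow> same_path G ((a \<star>\<^sub>1 b) \<star>\<^sub>1 c) (a \<star>\<^sub>1 (b \<star>\<^sub>1 c))"
| unit1_left: "has_type G a u v \<Longrightarrow> same_path G (Path u \<star>\<^sub>1 a) a"
| unit1_right: "has_type G a u v \<Longrightarrow> same_path G (a \<star>\<^sub>1 Path v) a"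
| assoc0: "has_type G ((a \<star>\<^sub>0 b) \<star>\<^sub>0 c) u v \<Longrightarrow> same_path G ((a \<star>\<^sub>0 b) \<star>\<^sub>0 c) (a \<star>\<^sub>0 (b \<star>\<^sub>0 c))"
| unit0_left: "has_type G a u v \<Longrightarrow> same_path G (Path [] \<star>\<^sub>0 a) a"
| unit0_right: "has_type G a u v \<Longrightarrow> same_path G (a \<star>\<^sub>0 Path []) a"
| path: "set u \<subseteq> cells1 G \<Longrightarrow> set v \<subseteq> cells1 G
    \<Longrightarrow> same_path G (Path u \<star>\<^sub>0 Path v) (Path (u @ v))"
| exchange: "has_type G ((a \<star>\<^sub>1 b) \<star>\<^sub>0 (c \<star>\<^sub>1 d)) u v
    \<Longrightarrow> same_path G ((a \<star>\<^sub>1 b) \<star>\<^sub>0 (c \<star>\<^sub>1 d)) ((a \<star>\<^sub>0 c) \<star>\<^sub>1 (b \<star>\<^sub>0 d))"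

type_synonym ('s, 'c) path2 = "('s, 'c) expr set"

definition path2_of :: "('s, 'c, 'r) polygraph \<Rightarrow> ('s, 'c) expr \<Rightarrow> ('s, 'c) path2" where
  "path2_of G a = {b. same_path G a b}"

definition paths2 ::
  "('s, 'c, 'r) polygraph \<Rightarrow> 's list \<Rightarrow> 's list \<Rightarrow> ('s, 'c) path2 set" where
  "paths2 G u v = {path2_of G a | a. has_type G a u v}"

definition comp0 ::
  "('s, 'c, 'r) polygraph \<Rightarrow> ('s, 'c) path2 \<Rightarrow> ('s, 'c) path2 \<Rightarrow> ('s, 'c) path2" where
  "comp0 G X Y = {c. \<exists>a\<in>X. \<exists>b\<in>Y. same_path G (a \<star>\<^sub>0 b) c}"

definition comp1 ::
  "('s, 'c, 'r) polygraph \<Rightarrow> ('s, 'c) path2 \<Rightarrow> ('s, 'c) path2 \<Rightarrow> ('s, 'c) path2" where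
  "comp1 G X Y = {c. \<exists>a\<in>X. \<exists>b\<in>Y. same_path G (a \<star>\<^sub>1 b) c}"

definition monoidal_3_polygraph :: "('s, 'c, 'r) polygraph \<Rightarrow> bool" where
  "monoidal_3_polygraph G \<longleftrightarrow>
     (\<forall>c\<in>cells2 G. set (src1 G c) \<subseteq> cells1 G \<and> set (tgt1 G c) \<subseteq> cells1 G) \<and>
     (\<forall>\<alpha>\<in>cells3 G. \<exists>u v. has_type G (src2 G \<alpha>) u v \<and> has_type G (tgt2 G \<alpha>) u v)"

definition in_context :: "('s, 'c) expr \<Rightarrow> 's list \<Rightarrow> ('s, 'c) expr \<Rightarrow> 's list \<Rightarrow> ('s, 'c) expr
    \<Rightarrow> ('s, 'c) expr" where
  "in_context h x a y k = h \<star>\<^sub>1 (Path x \<star>\<^sub>0 a \<star>\<^sub>0 Path y) \<star>\<^sub>1 k"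

definition rewrite_step ::
  "('s, 'c, 'r) polygraph \<Rightarrow> ('s, 'c) path2 \<Rightarrow> ('s, 'c) path2 \<Rightarrow> bool" where
  "rewrite_step G X Y \<longleftrightarrow> (\<exists>h x \<alpha> y k u v. \<alpha> \<in> cells3 G \<and>
     has_type G (in_context h x (src2 G \<alpha>) y k) u v \<and>
     X = path2_of G (in_context h x (src2 G \<alpha>) y k) \<and>
     Y = path2_of G (in_context h x (tgt2 G \<alpha>) y k))"

definition normal_form_of ::
  "('s, 'c, 'r) polygraph \<Rightarrow> ('s, 'c) path2 \<Rightarrow> ('s, 'c) path2 \<Rightarrow> bool" where
  "normal_form_of G X Y \<longleftrightarrow> (rewrite_step G)\<^sup>*\<^sup>* X Y \<and> (\<nexists>Z. rewrite_step G Y Z)"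

section \<open>Polygraphic programs\<close>

datatype ('s, 'k, 'f) cell2 = Perm 's 's | Dupl 's | Eras 's | Constr 'k | Fun 'f

text \<open>
  The first four kinds are the structure 3-cells: \<open>Perm_left \<gamma> \<zeta>\<close> for a constructor above the
  left input of a permutation, \<open>Perm_right \<zeta> \<gamma>\<close> for one above the right input.
\<close>

datatype ('s, 'k, 'r) cell3 =
  Perm_left 'k 's | Perm_right 's 'k | Dupl_constr 'k | Eras_constr 'k | Computation 'r

record ('s, 'k, 'f, 'r) program =
  sorts :: "'s set"
  constrs :: "'k set"
  constr_src :: "'k \<Rightarrow> 's list"
  constr_tgt :: "'k \<Rightarrow> 's"
  funs :: "'f set"
  fun_src :: "'f \<Rightarrow> 's list"
  fun_tgt :: "'f \<Rightarrow> 's list"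
  rules :: "'r set"
  rule_src :: "'r \<Rightarrow> ('s, ('s, 'k, 'f) cell2) expr"
  rule_tgt :: "'r \<Rightarrow> ('s, ('s, 'k, 'f) cell2) expr"

text \<open>
  Structure 2-cells extended to 1-paths:
  \<open>perm_word x \<zeta> : x \<star>\<^sub>0 \<zeta> \<Rightarrow> \<zeta> \<star>\<^sub>0 x\<close> and \<open>perm_sort \<zeta> x : \<zeta> \<star>\<^sub>0 x \<Rightarrow> x \<star>\<^sub>0 \<zeta>\<close>.
\<close>

primrec perm_word :: "'s list \<Rightarrow> 's \<Rightarrow> ('s, ('s, 'k, 'f) cell2) expr" where
  "perm_word [] \<zeta> = Path [\<zeta>]"
| "perm_word (\<xi> # x) \<zeta> =
     (Path [\<xi>] \<star>\<^sub>0 perm_word x \<zeta>) \<star>\<^sub>1 (Cell (Perm \<xi> \<zeta>) \<star>\<^sub>0 Path x)"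

primrec perm_sort :: "'s \<Rightarrow> 's list \<Rightarrow> ('s, ('s, 'k, 'f) cell2) expr" where
  "perm_sort \<zeta> [] = Path [\<zeta>]"
| "perm_sort \<zeta> (\<xi> # x) =
     (Cell (Perm \<zeta> \<xi>) \<star>\<^sub>0 Path x) \<star>\<^sub>1 (Path [\<xi>] \<star>\<^sub>0 perm_sort \<zeta> x)"

primrec dupl_word :: "'s list \<Rightarrow> ('s, ('s, 'k, 'f) cell2) expr" where
  "dupl_word [] = Path []"
| "dupl_word (\<xi> # x) =
     (Cell (Dupl \<xi>) \<star>\<^sub>0 dupl_word x) \<star>\<^sub>1 (Path [\<xi>] \<star>\<^sub>0 perm_sort \<xi> x \<star>\<^sub>0 Path x)"

primrec eras_word :: "'s list \<Rightarrow> ('s, ('s, 'k, 'f) cell2) expr" where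
  "eras_word [] = Path []"
| "eras_word (\<xi> # x) = Cell (Eras \<xi>) \<star>\<^sub>0 eras_word x"

definition program_cells2 :: "('s, 'k, 'f, 'r) program \<Rightarrow> ('s, 'k, 'f) cell2 set" where
  "program_cells2 P =
     {Perm \<xi> \<zeta> | \<xi> \<zeta>. \<xi> \<in> sorts P \<and> \<zeta> \<in> sorts P} \<union> Dupl ` sorts P \<union> Eras ` sorts P \<union>
     Constr ` constrs P \<union> Fun ` funs P"

primrec program_src1 :: "('s, 'k, 'f, 'r) program \<Rightarrow> ('s, 'k, 'f) cell2 \<Rightarrow> 's list" where
  "program_src1 P (Perm \<xi> \<zeta>) = [\<xi>, \<zeta>]"
| "program_src1 P (Dupl \<xi>) = [\<xi>]"
| "program_src1 P (Eras \<xi>) = [\<xi>]"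
| "program_src1 P (Constr \<gamma>) = constr_src P \<gamma>"
| "program_src1 P (Fun \<phi>) = fun_src P \<phi>"

primrec program_tgt1 :: "('s, 'k, 'f, 'r) program \<Rightarrow> ('s, 'k, 'f) cell2 \<Rightarrow> 's list" where
  "program_tgt1 P (Perm \<xi> \<zeta>) = [\<zeta>, \<xi>]"
| "program_tgt1 P (Dupl \<xi>) = [\<xi>, \<xi>]"
| "program_tgt1 P (Eras \<xi>) = []"
| "program_tgt1 P (Constr \<gamma>) = [constr_tgt P \<gamma>]"
| "program_tgt1 P (Fun \<phi>) = fun_tgt P \<phi>"

definition program_cells3 :: "('s, 'k, 'f, 'r) program \<Rightarrow> ('s, 'k, 'r) cell3 set" where
  "program_cells3 P =
     {Perm_left \<gamma> \<zeta> | \<gamma> \<zeta>. \<gamma> \<in> constrs P \<and> \<zeta> \<in> sorts P} \<union>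
     {Perm_right \<zeta> \<gamma> | \<zeta> \<gamma>. \<zeta> \<in> sorts P \<and> \<gamma> \<in> constrs P} \<union>
     Dupl_constr ` constrs P \<union> Eras_constr ` constrs P \<union> Computation ` rules P"

primrec program_src2 ::
  "('s, 'k, 'f, 'r) program \<Rightarrow> ('s, 'k, 'r) cell3 \<Rightarrow> ('s, ('s, 'k, 'f) cell2) expr" where
  "program_src2 P (Perm_left \<gamma> \<zeta>) =
     (Cell (Constr \<gamma>) \<star>\<^sub>0 Path [\<zeta>]) \<star>\<^sub>1 Cell (Perm (constr_tgt P \<gamma>) \<zeta>)"
| "program_src2 P (Perm_right \<zeta> \<gamma>) =
     (Path [\<zeta>] \<star>\<^sub>0 Cell (Constr \<gamma>)) \<star>\<^sub>1 Cell (Perm \<zeta> (constr_tgt P \<gamma>))"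
| "program_src2 P (Dupl_constr \<gamma>) = Cell (Constr \<gamma>) \<star>\<^sub>1 Cell (Dupl (constr_tgt P \<gamma>))"
| "program_src2 P (Eras_constr \<gamma>) = Cell (Constr \<gamma>) \<star>\<^sub>1 Cell (Eras (constr_tgt P \<gamma>))"
| "program_src2 P (Computation r) = rule_src P r"

primrec program_tgt2 ::
  "('s, 'k, 'f, 'r) program \<Rightarrow> ('s, 'k, 'r) cell3 \<Rightarrow> ('s, ('s, 'k, 'f) cell2) expr" where
  "program_tgt2 P (Perm_left \<gamma> \<zeta>) =
     perm_word (constr_src P \<gamma>) \<zeta> \<star>\<^sub>1 (Path [\<zeta>] \<star>\<^sub>0 Cell (Constr \<gamma>))"
| "program_tgt2 P (Perm_right \<zeta> \<gamma>) =
     perm_sort \<zeta> (constr_src P \<gamma>) \<star>\<^sub>1 (Cell (Constr \<gamma>) \<star>\<^sub>0 Path [\<zeta>])"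
| "program_tgt2 P (Dupl_constr \<gamma>) =
     dupl_word (constr_src P \<gamma>) \<star>\<^sub>1 (Cell (Constr \<gamma>) \<star>\<^sub>0 Cell (Constr \<gamma>))"
| "program_tgt2 P (Eras_constr \<gamma>) = eras_word (constr_src P \<gamma>)"
| "program_tgt2 P (Computation r) = rule_tgt P r"

definition polygraph_of ::
  "('s, 'k, 'f, 'r) program \<Rightarrow> ('s, ('s, 'k, 'f) cell2, ('s, 'k, 'r) cell3) polygraph" where
  "polygraph_of P =
    \<lparr> cells1 = sorts P,
      cells2 = program_cells2 P, src1 = program_src1 P, tgt1 = program_tgt1 P,
      cells3 = program_cells3 P, src2 = program_src2 P, tgt2 = program_tgt2 P \<rparr>"

definition only_constrs :: "('s, ('s, 'k, 'f) cell2) expr \<Rightarrow> bool" where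
  "only_constrs a \<longleftrightarrow> set (cells_of a) \<subseteq> range Constr"

primrec is_structure :: "('s, 'k, 'f) cell2 \<Rightarrow> bool" where
  "is_structure (Perm \<xi> \<zeta>) \<longleftrightarrow> True"
| "is_structure (Dupl \<xi>) \<longleftrightarrow> True"
| "is_structure (Eras \<xi>) \<longleftrightarrow> True"
| "is_structure (Constr \<gamma>) \<longleftrightarrow> False"
| "is_structure (Fun \<phi>) \<longleftrightarrow> False"

section \<open>Polynomial-time computability\<close>

text \<open>
  Polynomial time is taken in the WHILE language on binary trees (N. D. Jones, Computability
  and Complexity). Evaluating an expression is charged the size of every tree it produces:
  with unit costs, repeated \<open>X := cons X X\<close> would build trees of exponential size in linear time.
\<close>

datatype tree = Leaf | Node tree tree

primrec tree_size :: "tree \<Rightarrow> nat" where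
  "tree_size Leaf = 1"
| "tree_size (Node a b) = tree_size a + tree_size b + 1"

primrec left :: "tree \<Rightarrow> tree" where
  "left Leaf = Leaf"
| "left (Node a b) = a"

primrec right :: "tree \<Rightarrow> tree" where
  "right Leaf = Leaf"
| "right (Node a b) = b"

datatype tree_exp = Var nat | Nil_exp | Cons_exp tree_exp tree_exp | Hd_exp tree_exp | Tl_exp tree_exp

primrec tree_val :: "(nat \<Rightarrow> tree) \<Rightarrow> tree_exp \<Rightarrow> tree" where
  "tree_val s (Var i) = s i"
| "tree_val s Nil_exp = Leaf"
| "tree_val s (Cons_exp a b) = Node (tree_val s a) (tree_val s b)"
| "tree_val s (Hd_exp a) = left (tree_val s a)"
| "tree_val s (Tl_exp a) = right (tree_val s a)"

primrec exp_cost :: "(nat \<Rightarrow> tree) \<Rightarrow> tree_exp \<Rightarrow> nat" where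
  "exp_cost s (Var i) = tree_size (s i)"
| "exp_cost s Nil_exp = 1"
| "exp_cost s (Cons_exp a b) =
     exp_cost s a + exp_cost s b + tree_size (tree_val s (Cons_exp a b))"
| "exp_cost s (Hd_exp a) = exp_cost s a + tree_size (tree_val s (Hd_exp a))"
| "exp_cost s (Tl_exp a) = exp_cost s a + tree_size (tree_val s (Tl_exp a))"

datatype command =
    Assign nat tree_exp
  | Sequence command command
  | If tree_exp command command
  | While tree_exp command

inductive runs :: "command \<Rightarrow> (nat \<Rightarrow> tree) \<Rightarrow> nat \<Rightarrow> (nat \<Rightarrow> tree) \<Rightarrow> bool" where
  "runs (Assign i a) s (exp_cost s a) (s(i := tree_val s a))"
| "runs c s m s' \<Longrightarrow> runs d s' n s'' \<Longrightarrow> runs (Sequence c d) s (m + n) s''"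
| "tree_val s a \<noteq> Leaf \<Longrightarrow> runs c s n s' \<Longrightarrow> runs (If a c d) s (exp_cost s a + n) s'"
| "tree_val s a = Leaf \<Longrightarrow> runs d s n s' \<Longrightarrow> runs (If a c d) s (exp_cost s a + n) s'"
| "tree_val s a \<noteq> Leaf \<Longrightarrow> runs c s m s' \<Longrightarrow> runs (While a c) s' n s''
    \<Longrightarrow> runs (While a c) s (exp_cost s a + m + n) s''"
| "tree_val s a = Leaf \<Longrightarrow> runs (While a c) s (exp_cost s a) s"

text \<open>Input and output are in variable 0.\<close>

definition computes_tree_in :: "command \<Rightarrow> tree \<Rightarrow> nat \<Rightarrow> tree \<Rightarrow> bool" where
  "computes_tree_in c i n out \<longleftrightarrow> (\<exists>s. runs c ((\<lambda>_. Leaf)(0 := i)) n s \<and> s 0 = out)"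

primrec code_nat :: "nat \<Rightarrow> tree" where
  "code_nat 0 = Leaf"
| "code_nat (Suc n) = Node Leaf (code_nat n)"

primrec code_nats :: "nat list \<Rightarrow> tree" where
  "code_nats [] = Leaf"
| "code_nats (n # ns) = Node (code_nat n) (code_nats ns)"

primrec code_cell2 :: "(nat, nat, nat) cell2 \<Rightarrow> tree" where
  "code_cell2 (Perm \<xi> \<zeta>) = code_nats [0, \<xi>, \<zeta>]"
| "code_cell2 (Dupl \<xi>) = code_nats [1, \<xi>]"
| "code_cell2 (Eras \<xi>) = code_nats [2, \<xi>]"
| "code_cell2 (Constr \<gamma>) = code_nats [3, \<gamma>]"
| "code_cell2 (Fun \<phi>) = code_nats [4, \<phi>]"

primrec code_expr :: "(nat, (nat, nat, nat) cell2) expr \<Rightarrow> tree" where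
  "code_expr (Path u) = Node (code_nat 0) (code_nats u)"
| "code_expr (Cell c) = Node (code_nat 1) (code_cell2 c)"
| "code_expr (a \<star>\<^sub>0 b) = Node (code_nat 2) (Node (code_expr a) (code_expr b))"
| "code_expr (a \<star>\<^sub>1 b) = Node (code_nat 3) (Node (code_expr a) (code_expr b))"

primrec code_cell3 :: "(nat, nat, nat) cell3 \<Rightarrow> tree" where
  "code_cell3 (Perm_left \<gamma> \<zeta>) = code_nats [0, \<gamma>, \<zeta>]"
| "code_cell3 (Perm_right \<zeta> \<gamma>) = code_nats [1, \<zeta>, \<gamma>]"
| "code_cell3 (Dupl_constr \<gamma>) = code_nats [2, \<gamma>]"
| "code_cell3 (Eras_constr \<gamma>) = code_nats [3, \<gamma>]"
| "code_cell3 (Computation r) = code_nats [4, r]"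

text \<open>
  The input consists of a 3-cell and of the 2-path it is applied to, the latter being presented
  as an occurrence of the 2-source in a context; the output may be any expression of the result.
\<close>

definition polytime_rewriting :: "(nat, nat, nat, nat) program \<Rightarrow> bool" where
  "polytime_rewriting P \<longleftrightarrow> (let G = polygraph_of P in
     \<exists>c (p :: nat poly). \<forall>\<alpha>\<in>cells3 G. \<forall>h x y k u v.
       has_type G (in_context h x (src2 G \<alpha>) y k) u v \<longrightarrow>
       (let i = Node (code_cell3 \<alpha>) (code_expr (in_context h x (src2 G \<alpha>) y k)) in
        \<exists>n b. computes_tree_in c i n (code_expr b) \<and> n \<le> poly p (tree_size i) \<and>
              same_path G b (in_context h x (tgt2 G \<alpha>) y k)))"

text \<open>
  The names of cells are natural numbers, so that 2-paths have a canonical encoding.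
\<close>

definition polygraphic_program :: "(nat, nat, nat, nat) program \<Rightarrow> bool" where
  "polygraphic_program P \<longleftrightarrow>
     monoidal_3_polygraph (polygraph_of P) \<and>
     (\<forall>r\<in>rules P. \<exists>t \<phi>. \<phi> \<in> funs P \<and> only_constrs t \<and>
        same_path (polygraph_of P) (rule_src P r) (t \<star>\<^sub>1 Cell (Fun \<phi>))) \<and>
     (\<exists>K. \<forall>r\<in>rules P. length (filter is_structure (cells_of (rule_tgt P r))) \<le> K) \<and>
     polytime_rewriting P"

definition finite_program :: "('s, 'k, 'f, 'r) program \<Rightarrow> bool" where
  "finite_program P \<longleftrightarrow>
     finite (sorts P) \<and> finite (constrs P) \<and> finite (funs P) \<and> finite (rules P)"

section \<open>Semantics\<close>

definition vals ::
  "('s, 'k, 'f, 'r) program \<Rightarrow> 's \<Rightarrow> ('s, ('s, 'k, 'f) cell2) path2 set" where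
  "vals P \<xi> = {path2_of (polygraph_of P) a | a.
     has_type (polygraph_of P) a [] [\<xi>] \<and> only_constrs a}"

definition val_families ::
  "('s, 'k, 'f, 'r) program \<Rightarrow> 's list \<Rightarrow> ('s, ('s, 'k, 'f) cell2) path2 list set" where
  "val_families P u = {ts. list_all2 (\<lambda>t \<xi>. t \<in> vals P \<xi>) ts u}"

definition parallel :: "('s, 'k, 'f, 'r) program \<Rightarrow> ('s, ('s, 'k, 'f) cell2) path2 list
    \<Rightarrow> ('s, ('s, 'k, 'f) cell2) path2" where
  "parallel P ts = foldr (comp0 (polygraph_of P)) ts (path2_of (polygraph_of P) (Path []))"

text \<open>
  Values are constructor terms, and families of terms are compared lexicographically, following
  the order of the type of constructors; since arities are fixed, this is the lexicographic order on their
  prefix notations.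
\<close>

datatype 'k constr_term = Term 'k "'k constr_term list"

primrec term_expr :: "'k constr_term \<Rightarrow> ('s, ('s, 'k, 'f) cell2) expr" where
  "term_expr (Term \<gamma> ts) = foldr (\<star>\<^sub>0) (map term_expr ts) (Path []) \<star>\<^sub>1 Cell (Constr \<gamma>)"

primrec prefix_notation :: "'k constr_term \<Rightarrow> 'k list" where
  "prefix_notation (Term \<gamma> ts) = \<gamma> # concat (map prefix_notation ts)"

definition denotes_terms :: "('s, 'k, 'f, 'r) program \<Rightarrow> ('s, ('s, 'k, 'f) cell2) path2
    \<Rightarrow> 'k constr_term list \<Rightarrow> bool" where
  "denotes_terms P X ts \<longleftrightarrow> (let a = foldr (\<star>\<^sub>0) (map term_expr ts) (Path []) in
     X = path2_of (polygraph_of P) a \<and> (\<exists>v. has_type (polygraph_of P) a [] v))"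

definition val_le :: "('s, 'k :: linorder, 'f, 'r) program \<Rightarrow> ('s, ('s, 'k, 'f) cell2) path2
    \<Rightarrow> ('s, ('s, 'k, 'f) cell2) path2 \<Rightarrow> bool" where
  "val_le P X Y \<longleftrightarrow> (\<exists>ts us. denotes_terms P X ts \<and> denotes_terms P Y us \<and>
     ord_class.lexordp_eq (concat (map prefix_notation ts)) (concat (map prefix_notation us)))"

text \<open>
  The functions are partial, a total one being the case where \<open>g\<close> never takes the value \<open>None\<close>.
  At an argument outside the domain of \<open>g\<close> there must be no normal form.
\<close>

definition computes :: "('s, 'k :: linorder, 'f, 'r) program \<Rightarrow> 's list \<Rightarrow> 's list
    \<Rightarrow> ('s, ('s, 'k, 'f) cell2) path2
    \<Rightarrow> (('s, ('s, 'k, 'f) cell2) path2 list \<Rightarrow> ('s, ('s, 'k, 'f) cell2) path2 list option)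
    \<Rightarrow> bool" where
  "computes P u v F g \<longleftrightarrow> (let G = polygraph_of P in
     F \<in> paths2 G u v \<and>
     (\<forall>ts\<in>val_families P u. let X = comp1 G (parallel P ts) F in
        case g ts of
          None \<Rightarrow> \<nexists>Y. normal_form_of G X Y
        | Some us \<Rightarrow> us \<in> val_families P v \<and> normal_form_of G X (parallel P us) \<and>
            (\<not> confluentp (rewrite_step G) \<longrightarrow>
               (\<forall>Y. normal_form_of G X Y \<longrightarrow> val_le P Y (parallel P us)))))"

text \<open>
  The sort \<open>\<xi>\<close> represents the words over \<open>A\<close>, built from the empty word \<open>e\<close> and one unary
  constructor for each letter.
\<close>

definition word_sort ::
  "('s, 'k, 'f, 'r) program \<Rightarrow> 'a set \<Rightarrow> 's \<Rightarrow> 'k \<Rightarrow> ('a \<Rightarrow> 'k) \<Rightarrow> bool" where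
  "word_sort P A \<xi> e letter \<longleftrightarrow>
     \<xi> \<in> sorts P \<and> inj_on letter A \<and>
     {\<gamma> \<in> constrs P. constr_tgt P \<gamma> = \<xi>} = insert e (letter ` A) \<and>
     constr_src P e = [] \<and> (\<forall>a\<in>A. constr_src P (letter a) = [\<xi>])"

primrec word_expr :: "'k \<Rightarrow> ('a \<Rightarrow> 'k) \<Rightarrow> 'a list \<Rightarrow> ('s, ('s, 'k, 'f) cell2) expr" where
  "word_expr e letter [] = Cell (Constr e)"
| "word_expr e letter (a # w) = word_expr e letter w \<star>\<^sub>1 Cell (Constr (letter a))"

definition word_val :: "('s, 'k, 'f, 'r) program \<Rightarrow> 'k \<Rightarrow> ('a \<Rightarrow> 'k) \<Rightarrow> 'a list
    \<Rightarrow> ('s, ('s, 'k, 'f) cell2) path2" where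
  "word_val P e letter w = path2_of (polygraph_of P) (word_expr e letter w)"

section \<open>Turing machines\<close>

datatype direction = L | R

record ('q, 'a) tm =
  states :: "'q set"
  input_alphabet :: "'a set"
  tape_alphabet :: "'a set"
  blank :: 'a
  start :: 'q
  halting :: "'q set"
  delta :: "'q \<Rightarrow> 'a \<Rightarrow> 'q \<times> 'a \<times> direction"

definition turing_machine :: "('q, 'a) tm \<Rightarrow> bool" where
  "turing_machine M \<longleftrightarrow>
     finite (states M) \<and> finite (tape_alphabet M) \<and>
     input_alphabet M \<subseteq> tape_alphabet M \<and>
     blank M \<in> tape_alphabet M - input_alphabet M \<and>
     start M \<in> states M \<and> halting M \<subseteq> states M \<and>
     (\<forall>q\<in>states M - halting M. \<forall>a\<in>tape_alphabet M.
        delta M q a \<in> states M \<times> tape_alphabet M \<times> UNIV)"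

text \<open>
  A configuration \<open>(q, l, a, r)\<close> consists of the state, the tape to the left of the head in
  reverse order, the symbol read, and the tape to the right of the head; the rest of the tape,
  which is infinite in both directions, is blank.
\<close>

type_synonym ('q, 'a) config = "'q \<times> 'a list \<times> 'a \<times> 'a list"

definition head_or :: "'a \<Rightarrow> 'a list \<Rightarrow> 'a" where
  "head_or b w = (case w of [] \<Rightarrow> b | a # _ \<Rightarrow> a)"

definition initial_config :: "('q, 'a) tm \<Rightarrow> 'a list \<Rightarrow> ('q, 'a) config" where
  "initial_config M w = (start M, [], head_or (blank M) w, tl w)"

inductive tm_step :: "('q, 'a) tm \<Rightarrow> ('q, 'a) config \<Rightarrow> ('q, 'a) config \<Rightarrow> bool" for M where
  "q \<notin> halting M \<Longrightarrow> delta M q a = (q', b, L)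
    \<Longrightarrow> tm_step M (q, l, a, r) (q', tl l, head_or (blank M) l, b # r)"
| "q \<notin> halting M \<Longrightarrow> delta M q a = (q', b, R)
    \<Longrightarrow> tm_step M (q, l, a, r) (q', b # l, head_or (blank M) r, tl r)"

definition tm_halts_with :: "('q, 'a) tm \<Rightarrow> 'a list \<Rightarrow> 'a list \<Rightarrow> bool" where
  "tm_halts_with M w v \<longleftrightarrow> (\<exists>q l a r.
     (tm_step M)\<^sup>*\<^sup>* (initial_config M w) (q, l, a, r) \<and> q \<in> halting M \<and>
     v = takeWhile (\<lambda>b. b \<noteq> blank M) (a # r))"

definition tm_computes :: "('q, 'a) tm \<Rightarrow> ('a list \<Rightarrow> 'a list option) \<Rightarrow> bool" where
  "tm_computes M f \<longleftrightarrow> (\<forall>w\<in>lists (input_alphabet M).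
     case f w of
       None \<Rightarrow> \<nexists>v. tm_halts_with M w v
     | Some v \<Rightarrow> v \<in> lists (input_alphabet M) \<and> tm_halts_with M w v)"

end

theory Submission
  imports
    Defs
    "HOL-Library.Nat_Bijection"
begin

text \<open>
  The program simulates the machine by string rewriting. All its constructors and functions have
  one output and at most one input, and a 2-path without inputs made of such cells is just a word:
  a nullary constructor followed by unary cells. Reductions of a word do not create structure
  2-cells, and they happen only where a constructor meets a function. A configuration is therefore
  a pair of stacks, constructors for the tape to the right of the head and functions for the tape
  to the left, with at most one rule applicable at the boundary. As the program is deterministic on
  these words, each of them has at most one normal form, and it has one exactly when the machine
  halts. Confluence of the whole polygraph is not needed.
\<close>

section \<open>Linear 2-paths\<close>

text \<open>Two obstacles shape the proof. A 2-path is a class of expressions modulo the monoidal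
  laws, and a rewriting step may choose any representative, so the possible steps cannot be read off
  one expression. The invariant \<open>trace\<close> answers this: it respects the laws and recovers
  a word from each of its representatives, whatever context was chosen in it. Counting wires then
  shows that nothing stands beside the redex. The other obstacle is the two-sided tape, which a
  single wire must carry. Its left half is stored in what remains to be computed, as functions
  awaiting a constructor. To preserve this form, a function never writes a constructor behind
  itself: an output that has to wait is again stored as a function, \<open>Push\<close>. Partial
  functions require control in both directions. Every machine step costs at least one rewriting step
  and the relation is deterministic, so a normal form of any kind bounds the number of machine
  steps.\<close>

text \<open>Words of 2-cells are written output end first.\<close>

primrec comp_word :: "'s list \<Rightarrow> 'c list \<Rightarrow> ('s, 'c) expr" where
  "comp_word u [] = Path u"
| "comp_word u (c # w) = comp_word u w \<star>\<^sub>1 Cell c"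

primrec chain ::
  "('s, 'c, 'r) polygraph \<Rightarrow> 's list \<Rightarrow> 'c list \<Rightarrow> 's list \<Rightarrow> bool" where
  "chain G u [] v \<longleftrightarrow> u = v \<and> set u \<subseteq> cells1 G"
| "chain G u (c # w) v \<longleftrightarrow> c \<in> cells2 G \<and> v = tgt1 G c \<and> chain G u w (src1 G c)"

lemma cells_of_comp_word [simp]: "set (cells_of (comp_word u w)) = set w"
  by (induction w) auto

lemma comp_word_type: "chain G u w v \<Longrightarrow> has_type G (comp_word u w) u v"
proof (induction w arbitrary: v)
  case (Cons c w)
  then have "has_type G (comp_word u w) u (src1 G c)" "has_type G (Cell c) (src1 G c) v"
    using has_type.intros(2)[of c G] by auto
  then show ?case by (simp add: has_type.intros(4))
qed (simp add: has_type.intros(1))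

section \<open>Typing and equational reasoning for 2-paths\<close>

locale monoidal_polygraph =
  fixes G :: "('s, 'c, 'r) polygraph"
  assumes monoidal: "monoidal_3_polygraph G"
begin

text \<open>A boundary is computed even for ill-typed expressions, and the middle boundary of a
  composite is checked by \<open>well_typed\<close>. Typing is thus settled by simplification,
  without unknown middle words.\<close>

primrec dom1 :: "('s, 'c) expr \<Rightarrow> 's list" where
  "dom1 (Path u) = u"
| "dom1 (Cell c) = src1 G c"
| "dom1 (a \<star>\<^sub>0 b) = dom1 a @ dom1 b"
| "dom1 (a \<star>\<^sub>1 b) = dom1 a"

primrec cod1 :: "('s, 'c) expr \<Rightarrow> 's list" where
  "cod1 (Path u) = u"
| "cod1 (Cell c) = tgt1 G c"
| "cod1 (a \<star>\<^sub>0 b) = cod1 a @ cod1 b"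
| "cod1 (a \<star>\<^sub>1 b) = cod1 b"

primrec well_typed :: "('s, 'c) expr \<Rightarrow> bool" where
  "well_typed (Path u) \<longleftrightarrow> set u \<subseteq> cells1 G"
| "well_typed (Cell c) \<longleftrightarrow> c \<in> cells2 G"
| "well_typed (a \<star>\<^sub>0 b) \<longleftrightarrow> well_typed a \<and> well_typed b"
| "well_typed (a \<star>\<^sub>1 b) \<longleftrightarrow> well_typed a \<and> well_typed b \<and> cod1 a = dom1 b"

lemma has_typeD: "has_type G a u v \<Longrightarrow> well_typed a \<and> u = dom1 a \<and> v = cod1 a"
  by (induction rule: has_type.induct) auto

lemma has_typeI: "well_typed a \<Longrightarrow> has_type G a (dom1 a) (cod1 a)"
  by (induction a) (auto intro: has_type.intros)

lemma has_type_iff: "has_type G a u v \<longleftrightarrow> well_typed a \<and> u = dom1 a \<and> v = cod1 a"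
  using has_typeD has_typeI by blast

lemma cells2_typed: "c \<in> cells2 G \<Longrightarrow> set (src1 G c) \<subseteq> cells1 G \<and> set (tgt1 G c) \<subseteq> cells1 G"
  using monoidal by (simp add: monoidal_3_polygraph_def)

lemma well_typed_sorts: "well_typed a \<Longrightarrow> set (dom1 a) \<subseteq> cells1 G \<and> set (cod1 a) \<subseteq> cells1 G"
  by (induction a) (use cells2_typed in auto)

lemma same_path_typed:
  "same_path G a b \<Longrightarrow> well_typed a \<and> well_typed b \<and> dom1 a = dom1 b \<and> cod1 a = cod1 b"
  by (induction rule: same_path.induct) (use well_typed_sorts in \<open>auto simp: has_type_iff\<close>)

text \<open>Both sides of every axiom contain the same cells. This transfers the absence of
  structure 2-cells from one representative to all of them.\<close>

lemma same_path_cells: "same_path G a b \<Longrightarrow> set (cells_of a) = set (cells_of b)"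
  by (induction rule: same_path.induct) auto

abbreviation eqv (infix "\<approx>" 50) where "a \<approx> b \<equiv> same_path G a b"

lemma eqv_refl: "well_typed a \<Longrightarrow> a \<approx> a"
  using same_path.refl has_typeI by blast

lemma eqv_unit1_left: "well_typed a \<Longrightarrow> u = dom1 a \<Longrightarrow> Path u \<star>\<^sub>1 a \<approx> a"
  using same_path.unit1_left has_typeI by blast

lemma eqv_unit1_right: "well_typed a \<Longrightarrow> v = cod1 a \<Longrightarrow> a \<star>\<^sub>1 Path v \<approx> a"
  using same_path.unit1_right has_typeI by blast

lemma eqv_unit0_left: "well_typed a \<Longrightarrow> Path [] \<star>\<^sub>0 a \<approx> a"
  using same_path.unit0_left has_typeI by blast

lemma eqv_unit0_right: "well_typed a \<Longrightarrow> a \<star>\<^sub>0 Path [] \<approx> a"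
  using same_path.unit0_right has_typeI by blast

lemma eqv_assoc0: "well_typed ((a \<star>\<^sub>0 b) \<star>\<^sub>0 c) \<Longrightarrow> (a \<star>\<^sub>0 b) \<star>\<^sub>0 c \<approx> a \<star>\<^sub>0 (b \<star>\<^sub>0 c)"
  using same_path.assoc0 has_typeI by blast

lemma eqv_assoc1: "well_typed ((a \<star>\<^sub>1 b) \<star>\<^sub>1 c) \<Longrightarrow> (a \<star>\<^sub>1 b) \<star>\<^sub>1 c \<approx> a \<star>\<^sub>1 (b \<star>\<^sub>1 c)"
  using same_path.assoc1 has_typeI by blast

lemma eqv_exchange:
  "well_typed ((a \<star>\<^sub>1 b) \<star>\<^sub>0 (c \<star>\<^sub>1 d)) \<Longrightarrow> (a \<star>\<^sub>1 b) \<star>\<^sub>0 (c \<star>\<^sub>1 d) \<approx> (a \<star>\<^sub>0 c) \<star>\<^sub>1 (b \<star>\<^sub>0 d)"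
  using same_path.exchange has_typeI by blast

lemma eqv_cong1: "a \<approx> a' \<Longrightarrow> b \<approx> b' \<Longrightarrow> cod1 a = dom1 b \<Longrightarrow> a \<star>\<^sub>1 b \<approx> a' \<star>\<^sub>1 b'"
  by (rule same_path.cong1) (use same_path_typed in \<open>auto simp: has_type_iff\<close>)

lemmas [trans] = same_path.trans

lemma path2_of_eq_iff: "well_typed a \<Longrightarrow> path2_of G a = path2_of G b \<longleftrightarrow> a \<approx> b"
  unfolding path2_of_def using eqv_refl same_path.sym same_path.trans by blast

lemma path2_of_eqI: "a \<approx> b \<Longrightarrow> path2_of G a = path2_of G b"
  unfolding path2_of_def using same_path.sym same_path.trans by blast

lemma comp0_path2_of:
  assumes "well_typed a" "well_typed b"
  shows "comp0 G (path2_of G a) (path2_of G b) = path2_of G (a \<star>\<^sub>0 b)"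
  using assms eqv_refl same_path.cong0 same_path.trans
  unfolding comp0_def path2_of_def by blast

lemma comp1_path2_of:
  assumes "well_typed (a \<star>\<^sub>1 b)"
  shows "comp1 G (path2_of G a) (path2_of G b) = path2_of G (a \<star>\<^sub>1 b)"
proof -
  have "a' \<star>\<^sub>1 b' \<approx> c \<Longrightarrow> a \<approx> a' \<Longrightarrow> b \<approx> b' \<Longrightarrow> a \<star>\<^sub>1 b \<approx> c" for a' b' c
    using assms same_path.trans[OF eqv_cong1] by auto
  then show ?thesis
    unfolding comp1_def path2_of_def
    using assms eqv_refl[of a] eqv_refl[of b] by (auto simp del: well_typed.simps) auto
qed

text \<open>
  A model of the axioms: each wire carries the list of cells passed on the way to it, most recent
  first. It is faithful on closed 2-paths without branching.
\<close>

primrec trace :: "('s, 'c) expr \<Rightarrow> 'c list list \<Rightarrow> 'c list list" where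
  "trace (Path u) ws = ws"
| "trace (Cell c) ws = replicate (length (tgt1 G c)) (c # concat ws)"
| "trace (a \<star>\<^sub>0 b) ws =
     trace a (take (length (dom1 a)) ws) @ trace b (drop (length (dom1 a)) ws)"
| "trace (a \<star>\<^sub>1 b) ws = trace b (trace a ws)"

lemma length_trace:
  "well_typed a \<Longrightarrow> length ws = length (dom1 a) \<Longrightarrow> length (trace a ws) = length (cod1 a)"
  by (induction a arbitrary: ws) auto

text \<open>Each law becomes an identity of lists. For the exchange law, \<open>length_trace\<close>
  guarantees that the cut made by \<open>take\<close> and \<open>drop\<close> after the first layer
  falls between the two factors.\<close>

lemma trace_same_path:
  "a \<approx> b \<Longrightarrow> length ws = length (dom1 a) \<Longrightarrow> trace a ws = trace b ws"
proof (induction arbitrary: ws rule: same_path.induct)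
  case (sym a b)
  then show ?case using same_path_typed by metis
next
  case (trans a b c)
  then show ?case using same_path_typed by metis
next
  case (cong0 a a' b b')
  then show ?case using same_path_typed[OF cong0(1)] by simp
next
  case (cong1 a a' b b' u v)
  then show ?case using same_path_typed[OF cong1(1)] by (simp add: has_type_iff length_trace)
next
  case (exchange a b c d u v)
  then show ?case by (simp add: has_type_iff length_trace)
qed (auto simp: has_type_iff length_trace take_add drop_take add.commute)

section \<open>Traces of linear 2-paths\<close>

lemma dom1_comp_word [simp]: "dom1 (comp_word u w) = u"
  by (induction w) auto

lemma comp_word_typed: "chain G u w v \<Longrightarrow> well_typed (comp_word u w) \<and> cod1 (comp_word u w) = v"
  using comp_word_type[of G u w v] by (auto simp: has_type_iff)

lemma chain_append: "chain G u (w @ w') v \<longleftrightarrow> (\<exists>x. chain G u w' x \<and> chain G x w v)"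
proof (induction w arbitrary: v)
  case Nil
  have "chain G u w' v \<Longrightarrow> set v \<subseteq> cells1 G"
    using comp_word_typed well_typed_sorts by blast
  then show ?case by auto
qed auto

definition linear :: "'c \<Rightarrow> bool" where
  "linear c \<longleftrightarrow> length (tgt1 G c) = 1 \<and> length (src1 G c) \<le> 1"

lemma linear_cases:
  assumes "linear c"
  obtains s where "tgt1 G c = [s]" "src1 G c = []"
  | s s' where "tgt1 G c = [s]" "src1 G c = [s']"
  using assms unfolding linear_def
  by (metis One_nat_def le_Suc_eq le_zero_eq length_0_conv length_Suc_conv)

text \<open>No linear cell has fewer outputs than inputs, so wires never disappear. This later
  confines a rewriting context to a single wire.\<close>

lemma linear_dom_le_cod:
  "well_typed a \<Longrightarrow> \<forall>c\<in>set (cells_of a). linear c \<Longrightarrow> length (dom1 a) \<le> length (cod1 a)"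
proof (induction a)
  case (Comp0 a b)
  then show ?case by (simp add: add_mono)
qed (auto simp: linear_def)

text \<open>\<open>concat ws\<close> serves a first cell of either arity: without input wires it is
  empty. The empty word is excluded because it leaves \<open>ws\<close> as it is.\<close>

lemma trace_comp_word:
  assumes "\<forall>c\<in>set w. linear c" "w \<noteq> []"
  shows "trace (comp_word u w) ws = [w @ concat ws]"
  using assms
proof (induction w)
  case (Cons c w)
  then show ?case by (cases w) (auto simp: linear_def)
qed simp

text \<open>Equality of the lengths says that there are no nullary cells.\<close>

lemma trace_prepends:
  assumes "well_typed a" "\<forall>c\<in>set (cells_of a). linear c" "length (dom1 a) = length (cod1 a)"
  shows "\<exists>ks. length ks = length (dom1 a) \<and>
    (\<forall>ws. length ws = length (dom1 a) \<longrightarrow> trace a ws = map2 (@) ks ws)"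
  using assms
proof (induction a)
  case (Path u)
  have "trace (Path u) ws = map2 (@) (replicate (length u) []) ws"
    if "length ws = length u" for ws :: "'c list list"
    using that by (intro nth_equalityI) auto
  then show ?case by (intro exI[of _ "replicate (length u) []"]) auto
next
  case (Cell c)
  then obtain s s' where "tgt1 G c = [s]" "src1 G c = [s']"
    using linear_cases[of c]
    by (metis cells_of.simps(2) cod1.simps(2) dom1.simps(2) length_Suc_conv list.set_intros(1)
        list.size(3) nat.simps(3))
  then have "\<forall>ws. length ws = 1 \<longrightarrow> trace (Cell c) ws = map2 (@) [[c]] ws"
    by (auto simp: length_Suc_conv)
  then show ?case using \<open>src1 G c = [s']\<close> by (intro exI[of _ "[[c]]"]) auto
next
  case (Comp0 a b)
  have "length (dom1 a) \<le> length (cod1 a)" "length (dom1 b) \<le> length (cod1 b)"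
    using Comp0.prems linear_dom_le_cod by auto
  \<comment> \<open>The two inequalities add up to an equality, so neither is strict.\<close>
  then have "length (dom1 a) = length (cod1 a)" "length (dom1 b) = length (cod1 b)"
    using Comp0.prems(3) by auto
  then obtain ks ls where
    ks: "length ks = length (dom1 a)"
      "\<forall>ws. length ws = length (dom1 a) \<longrightarrow> trace a ws = map2 (@) ks ws" and
    ls: "length ls = length (dom1 b)"
      "\<forall>ws. length ws = length (dom1 b) \<longrightarrow> trace b ws = map2 (@) ls ws"
    using Comp0 by auto
  have "trace (a \<star>\<^sub>0 b) ws = map2 (@) (ks @ ls) ws"
    if "length ws = length (dom1 (a \<star>\<^sub>0 b))" for ws
    using that ks ls by (simp add: zip_append1)
  then show ?case using ks(1) ls(1) by (intro exI[of _ "ks @ ls"]) auto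
next
  case (Comp1 a b)
  have "length (dom1 a) \<le> length (cod1 a)" "length (dom1 b) \<le> length (cod1 b)"
    using Comp1.prems linear_dom_le_cod[of a] linear_dom_le_cod[of b] by auto
  \<comment> \<open>The boundaries of \<open>a\<close> and \<open>b\<close> have weakly increasing
    lengths, and the first equals the last, so all are equal.\<close>
  then have le: "length (dom1 a) = length (cod1 a)" "length (dom1 b) = length (cod1 b)"
    using Comp1.prems by auto
  then obtain ks ls where
    ks: "length ks = length (dom1 a)"
      "\<forall>ws. length ws = length (dom1 a) \<longrightarrow> trace a ws = map2 (@) ks ws" and
    ls: "length ls = length (dom1 b)"
      "\<forall>ws. length ws = length (dom1 b) \<longrightarrow> trace b ws = map2 (@) ls ws"
    using Comp1 by auto
  \<comment> \<open>The cells of \<open>b\<close> are passed later and hence stand in front.\<close>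
  have "trace (a \<star>\<^sub>1 b) ws = map2 (@) (map2 (@) ls ks) ws"
    if "length ws = length (dom1 (a \<star>\<^sub>1 b))" for ws
    using that ks ls le Comp1.prems(1) by (auto intro!: nth_equalityI)
  then show ?case using ks(1) ls(1) le Comp1.prems(1)
    by (intro exI[of _ "map2 (@) ls ks"]) auto
qed

section \<open>Closed linear 2-paths with one output are words\<close>

definition juxtapose :: "'c list list \<Rightarrow> ('s, 'c) expr" where
  "juxtapose ws = foldr (\<star>\<^sub>0) (map (comp_word []) ws) (Path [])"

lemma juxtapose_typed:
  "list_all2 (\<lambda>w s. chain G [] w [s]) ws u \<Longrightarrow>
    well_typed (juxtapose ws) \<and> dom1 (juxtapose ws) = [] \<and> cod1 (juxtapose ws) = u"
proof (induction ws arbitrary: u)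
  case Nil
  then show ?case by (simp add: juxtapose_def)
next
  case (Cons w ws)
  then obtain s u' where u: "u = s # u'" "chain G [] w [s]" "list_all2 (\<lambda>w s. chain G [] w [s]) ws u'"
    by (auto simp: list_all2_Cons1)
  then show ?case using Cons.IH[OF u(3)] comp_word_typed[OF u(2)]
    by (simp add: juxtapose_def)
qed

lemma juxtapose_append:
  assumes "\<forall>w\<in>set (ws @ ws'). well_typed (comp_word [] w)"
  shows "juxtapose (ws @ ws') \<approx> juxtapose ws \<star>\<^sub>0 juxtapose ws'"
proof -
  have wt: "\<forall>w\<in>set ws. well_typed (comp_word [] w) \<Longrightarrow> well_typed (juxtapose ws)" for ws
    by (induction ws) (auto simp: juxtapose_def)
  from assms show ?thesis
  proof (induction ws)
    case Nil
    then show ?case using same_path.sym[OF eqv_unit0_left[OF wt[of ws']]] by (simp add: juxtapose_def)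
  next
    case (Cons w ws)
    have eq: "juxtapose (w # vs) = comp_word [] w \<star>\<^sub>0 juxtapose vs" for vs
      by (simp add: juxtapose_def)
    have "juxtapose ((w # ws) @ ws') \<approx> comp_word [] w \<star>\<^sub>0 (juxtapose ws \<star>\<^sub>0 juxtapose ws')"
      using Cons eqv_refl by (simp add: eq same_path.cong0)
    also have "\<dots> \<approx> juxtapose (w # ws) \<star>\<^sub>0 juxtapose ws'"
      unfolding eq using Cons.prems wt by (intro same_path.sym[OF eqv_assoc0]) simp
    finally show ?case .
  qed
qed

text \<open>A converse to the invariance of traces: on linear cells the trace determines the class.
  The inputs are plugged with arbitrary closed words because a cell of \<open>a\<close> is then
  absorbed into the word arriving at it, a parallel composite splits by the exchange law, and a
  sequential one passes on the words produced by its first factor.\<close>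

lemma juxtapose_comp:
  assumes "well_typed a" "\<forall>c\<in>set (cells_of a). linear c"
    and "list_all2 (\<lambda>w s. chain G [] w [s]) ws (dom1 a)"
  shows "juxtapose ws \<star>\<^sub>1 a \<approx> juxtapose (trace a ws) \<and>
    list_all2 (\<lambda>w s. chain G [] w [s]) (trace a ws) (cod1 a)"
  using assms
proof (induction a arbitrary: ws)
  case (Path u)
  then show ?case using eqv_unit1_right[of "juxtapose ws" u] juxtapose_typed[OF Path.prems(3)] by simp
next
  case (Cell c)
  then have "linear c" by simp
  then obtain s where tgt: "tgt1 G c = [s]" using linear_cases[of c] by metis
  have tr: "trace (Cell c) ws = [c # concat ws]" using tgt by simp
  \<comment> \<open>A linear cell receives no word or one; \<open>concat ws\<close> is the empty
    word or that word.\<close>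
  have "juxtapose ws \<approx> comp_word [] (concat ws) \<and> chain G [] (concat ws) (src1 G c)"
    using \<open>linear c\<close>
  proof (cases rule: linear_cases)
    case 1
    then show ?thesis using Cell.prems eqv_refl by (simp add: juxtapose_def)
  next
    case (2 s s')
    then obtain w where w: "ws = [w]" "chain G [] w [s']"
      using Cell.prems by (auto simp: list_all2_Cons2)
    then show ?thesis using 2 eqv_unit0_right comp_word_typed[OF w(2)]
      by (simp add: juxtapose_def)
  qed
  then have ch: "chain G [] (concat ws) (src1 G c)" and eqv: "juxtapose ws \<approx> comp_word [] (concat ws)"
    by auto
  have ch': "chain G [] (c # concat ws) [s]" using ch tgt Cell.prems by simp
  have "juxtapose ws \<star>\<^sub>1 Cell c \<approx> comp_word [] (c # concat ws)"
    using eqv_cong1[OF eqv eqv_refl[of "Cell c"]] Cell.prems juxtapose_typed[OF Cell.prems(3)] by simp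
  also have "\<dots> \<approx> juxtapose [c # concat ws]"
    using same_path.sym[OF eqv_unit0_right] comp_word_typed[OF ch'] by (simp add: juxtapose_def)
  finally show ?case using tr ch' tgt by simp
next
  case (Comp0 a b)
  let ?n = "length (dom1 a)"
  let ?ws = "take ?n ws" and ?vs = "drop ?n ws"
  have all: "list_all2 (\<lambda>w s. chain G [] w [s]) ?ws (dom1 a)"
    "list_all2 (\<lambda>w s. chain G [] w [s]) ?vs (dom1 b)"
    using Comp0.prems(3) list_all2_takeI[of _ ws "dom1 a @ dom1 b" ?n]
      list_all2_dropI[of _ ws "dom1 a @ dom1 b" ?n] by auto
  have IH: "juxtapose ?ws \<star>\<^sub>1 a \<approx> juxtapose (trace a ?ws)"
    "list_all2 (\<lambda>w s. chain G [] w [s]) (trace a ?ws) (cod1 a)"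
    "juxtapose ?vs \<star>\<^sub>1 b \<approx> juxtapose (trace b ?vs)"
    "list_all2 (\<lambda>w s. chain G [] w [s]) (trace b ?vs) (cod1 b)"
    using Comp0.IH all Comp0.prems by auto
  have wt: "\<forall>w\<in>set ws. well_typed (comp_word [] w)"
    if "list_all2 (\<lambda>w s. chain G [] w [s]) ws u" for ws u
    using that comp_word_typed by (fastforce simp: list_all2_conv_all_nth in_set_conv_nth)
  have "juxtapose ws \<star>\<^sub>1 (a \<star>\<^sub>0 b) \<approx> (juxtapose ?ws \<star>\<^sub>0 juxtapose ?vs) \<star>\<^sub>1 (a \<star>\<^sub>0 b)"
  proof (rule eqv_cong1)
    show "juxtapose ws \<approx> juxtapose ?ws \<star>\<^sub>0 juxtapose ?vs"
      using juxtapose_append[of ?ws ?vs] wt[OF Comp0.prems(3)] by simp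
    show "a \<star>\<^sub>0 b \<approx> a \<star>\<^sub>0 b" using Comp0.prems eqv_refl by simp
    show "cod1 (juxtapose ws) = dom1 (a \<star>\<^sub>0 b)" using juxtapose_typed[OF Comp0.prems(3)] by simp
  qed
  also have "\<dots> \<approx> (juxtapose ?ws \<star>\<^sub>1 a) \<star>\<^sub>0 (juxtapose ?vs \<star>\<^sub>1 b)"
    by (rule same_path.sym[OF eqv_exchange]) (use Comp0.prems all juxtapose_typed in simp)
  also have "\<dots> \<approx> juxtapose (trace a ?ws) \<star>\<^sub>0 juxtapose (trace b ?vs)"
    using IH by (intro same_path.cong0)
  also have "\<dots> \<approx> juxtapose (trace (a \<star>\<^sub>0 b) ws)"
    using same_path.sym[OF juxtapose_append] wt[OF IH(2)] wt[OF IH(4)] by auto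
  finally show ?case using IH(2,4) by (auto intro: list_all2_appendI)
next
  case (Comp1 a b)
  have IH1: "juxtapose ws \<star>\<^sub>1 a \<approx> juxtapose (trace a ws)"
    "list_all2 (\<lambda>w s. chain G [] w [s]) (trace a ws) (cod1 a)"
    using Comp1.IH(1) Comp1.prems by auto
  have IH2: "juxtapose (trace a ws) \<star>\<^sub>1 b \<approx> juxtapose (trace b (trace a ws))"
    "list_all2 (\<lambda>w s. chain G [] w [s]) (trace b (trace a ws)) (cod1 b)"
    using Comp1.IH(2)[of "trace a ws"] IH1(2) Comp1.prems by auto
  have "juxtapose ws \<star>\<^sub>1 (a \<star>\<^sub>1 b) \<approx> (juxtapose ws \<star>\<^sub>1 a) \<star>\<^sub>1 b"
    by (rule same_path.sym[OF eqv_assoc1]) (use Comp1.prems juxtapose_typed[OF Comp1.prems(3)] in simp)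
  also have "\<dots> \<approx> juxtapose (trace a ws) \<star>\<^sub>1 b"
    by (rule eqv_cong1[OF IH1(1) eqv_refl]) (use Comp1.prems in auto)
  also note IH2(1)
  finally show ?case using IH2(2) by simp
qed

text \<open>This is \<open>juxtapose_comp\<close> without input words: one output leaves a
  juxtaposition of a single word.\<close>

lemma closed_linear_word:
  assumes "has_type G a [] [s]" "\<forall>c\<in>set (cells_of a). linear c"
  obtains w where "trace a [] = [w]" "a \<approx> comp_word [] w" "chain G [] w [s]" "set w = set (cells_of a)"
proof -
  have wt: "well_typed a" "dom1 a = []" "cod1 a = [s]" using assms by (auto simp: has_type_iff)
  then have j: "juxtapose [] \<star>\<^sub>1 a \<approx> juxtapose (trace a [])"
    "list_all2 (\<lambda>w s. chain G [] w [s]) (trace a []) [s]"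
    using juxtapose_comp[of a "[]"] assms(2) by auto
  from j(2) obtain w where w: "trace a [] = [w]" "chain G [] w [s]"
    by (auto simp: list_all2_Cons2)
  have "a \<approx> Path [] \<star>\<^sub>1 a" using same_path.sym[OF eqv_unit1_left[of a "[]"]] wt by simp
  also have "\<dots> \<approx> comp_word [] w \<star>\<^sub>0 Path []" using j w by (simp add: juxtapose_def)
  also have "\<dots> \<approx> comp_word [] w" using eqv_unit0_right comp_word_typed[OF w(2)] by simp
  finally have "a \<approx> comp_word [] w" .
  moreover then have "set w = set (cells_of a)" using same_path_cells by fastforce
  ultimately show thesis using that w by blast
qed

text \<open>The trace returns the word itself, so it separates distinct words.\<close>

lemma comp_word_eqv_iff:
  assumes "chain G [] w [s]" "\<forall>c\<in>set w. linear c" "chain G [] w' [s']" "\<forall>c\<in>set w'. linear c"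
  shows "comp_word [] w \<approx> comp_word [] w' \<longleftrightarrow> w = w'"
proof
  assume "comp_word [] w \<approx> comp_word [] w'"
  then have "trace (comp_word [] w) [] = trace (comp_word [] w') []"
    using trace_same_path by simp
  moreover have "w \<noteq> []" "w' \<noteq> []" using assms by auto
  ultimately show "w = w'" using assms trace_comp_word[of w "[]" "[]"] trace_comp_word[of w' "[]" "[]"]
    by simp
qed (use assms comp_word_typed eqv_refl in auto)

end

section \<open>Finite programs rewrite in polynomial time\<close>

definition input_state :: "tree \<Rightarrow> nat \<Rightarrow> tree" where
  "input_state i = (\<lambda>_. Leaf)(0 := i)"

lemma input_state_simps [simp]: "input_state i 0 = i" "n \<noteq> 0 \<Longrightarrow> input_state i n = Leaf"
  by (simp_all add: input_state_def)

lemma computes_tree_in_iff: "computes_tree_in c i n t \<longleftrightarrow> (\<exists>s. runs c (input_state i) n s \<and> s 0 = t)"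
  by (simp add: computes_tree_in_def input_state_def)

text \<open>Additive constants are absorbed by \<open>B\<close>, every tree having size at least
  1.\<close>

definition linear_time :: "(tree \<Rightarrow> tree) \<Rightarrow> bool" where
  "linear_time f \<longleftrightarrow> (\<exists>c B. \<forall>i. \<exists>n. computes_tree_in c i n (f i) \<and> n \<le> B * tree_size i)"

lemma tree_size_pos: "tree_size t \<ge> 1"
  by (cases t) auto

lemma tree_size_left: "tree_size (left t) \<le> tree_size t"
  by (cases t) auto

lemma tree_size_right: "tree_size (right t) \<le> tree_size t"
  by (cases t) auto

text \<open>The cost of \<open>Cons_exp\<close>, \<open>Hd_exp\<close> and \<open>Tl_exp\<close>
  includes the size of the value produced, so the size bound has to accompany the cost bound through
  the induction.\<close>

lemma exp_cost_linear:
  "\<exists>B. \<forall>i. tree_size (tree_val (input_state i) e) \<le> B * tree_size i \<and>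
    exp_cost (input_state i) e \<le> B * tree_size i"
proof (induction e)
  case (Var n)
  have "input_state i n = i \<or> input_state i n = Leaf" for i
    by (cases "n = 0") simp_all
  then have "tree_size (input_state i n) \<le> tree_size i" for i
    using tree_size_pos by (metis order_refl tree_size.simps(1))
  then show ?case by (intro exI[of _ 1]) auto
next
  case Nil_exp
  then show ?case using tree_size_pos by (intro exI[of _ 1]) auto
next
  case (Cons_exp a b)
  then obtain A B where AB:
    "\<forall>i. tree_size (tree_val (input_state i) a) \<le> A * tree_size i \<and>
      exp_cost (input_state i) a \<le> A * tree_size i"
    "\<forall>i. tree_size (tree_val (input_state i) b) \<le> B * tree_size i \<and>
      exp_cost (input_state i) b \<le> B * tree_size i"
    by blast
  \<comment> \<open>The subexpressions cost \<open>A + B\<close> times the input size, the new tree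
    adds another \<open>A + B\<close> for its subtrees, and its root is charged to the summand
    1.\<close>
  have "tree_size (tree_val (input_state i) (Cons_exp a b)) \<le> (2 * A + 2 * B + 1) * tree_size i \<and>
      exp_cost (input_state i) (Cons_exp a b) \<le> (2 * A + 2 * B + 1) * tree_size i" for i
  proof -
    have "(2 * A + 2 * B + 1) * tree_size i =
        2 * (A * tree_size i) + 2 * (B * tree_size i) + tree_size i"
      by (simp add: algebra_simps)
    with AB[rule_format, of i] tree_size_pos[of i] show ?thesis
      unfolding tree_val.simps exp_cost.simps tree_size.simps
      by linarith
  qed
  then show ?case by blast
next
  case (Hd_exp e)
  then obtain B where B: "\<forall>i. tree_size (tree_val (input_state i) e) \<le> B * tree_size i \<and>
      exp_cost (input_state i) e \<le> B * tree_size i" by auto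
  have "tree_size (tree_val (input_state i) (Hd_exp e)) \<le> (2 * B) * tree_size i \<and>
      exp_cost (input_state i) (Hd_exp e) \<le> (2 * B) * tree_size i" for i
    using B[rule_format, of i] tree_size_left[of "tree_val (input_state i) e"] by simp
  then show ?case by blast
next
  case (Tl_exp e)
  then obtain B where B: "\<forall>i. tree_size (tree_val (input_state i) e) \<le> B * tree_size i \<and>
      exp_cost (input_state i) e \<le> B * tree_size i" by auto
  have "tree_size (tree_val (input_state i) (Tl_exp e)) \<le> (2 * B) * tree_size i \<and>
      exp_cost (input_state i) (Tl_exp e) \<le> (2 * B) * tree_size i" for i
    using B[rule_format, of i] tree_size_right[of "tree_val (input_state i) e"] by simp
  then show ?case by blast
qed

lemma linear_time_val: "linear_time (\<lambda>i. tree_val (input_state i) e)"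
proof -
  obtain B where "\<forall>i. exp_cost (input_state i) e \<le> B * tree_size i"
    using exp_cost_linear by blast
  moreover have "computes_tree_in (Assign 0 e) i (exp_cost (input_state i) e)
    (tree_val (input_state i) e)" for i
    unfolding computes_tree_in_iff using runs.intros(1)[of 0 e "input_state i"] by fastforce
  ultimately show ?thesis unfolding linear_time_def by blast
qed

text \<open>A test leaves the store unchanged, so the chosen branch starts on the original
  input.\<close>

lemma linear_time_if:
  assumes "linear_time f" "linear_time g"
  shows "linear_time (\<lambda>i. if tree_val (input_state i) e = Leaf then f i else g i)"
proof -
  obtain B where B: "\<forall>i. exp_cost (input_state i) e \<le> B * tree_size i"
    using exp_cost_linear by blast
  obtain c C where C: "\<forall>i. \<exists>n. computes_tree_in c i n (f i) \<and> n \<le> C * tree_size i"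
    using assms(1) unfolding linear_time_def by blast
  obtain d D where D: "\<forall>i. \<exists>n. computes_tree_in d i n (g i) \<and> n \<le> D * tree_size i"
    using assms(2) unfolding linear_time_def by blast
  have "\<exists>n. computes_tree_in (If e d c) i n
      (if tree_val (input_state i) e = Leaf then f i else g i) \<and>
      n \<le> (B + C + D) * tree_size i" for i
  proof (cases "tree_val (input_state i) e = Leaf")
    case True
    obtain n s where n: "runs c (input_state i) n s" "s 0 = f i" "n \<le> C * tree_size i"
      using C unfolding computes_tree_in_iff by blast
    have "exp_cost (input_state i) e + n \<le> (B + C + D) * tree_size i"
      using add_mono[OF B[rule_format, of i] n(3)] by (simp add: algebra_simps)
    with True show ?thesis unfolding computes_tree_in_iff
      using runs.intros(4)[OF True n(1)] n(2) by force
  next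
    case False
    obtain n s where n: "runs d (input_state i) n s" "s 0 = g i" "n \<le> D * tree_size i"
      using D unfolding computes_tree_in_iff by blast
    have "exp_cost (input_state i) e + n \<le> (B + C + D) * tree_size i"
      using add_mono[OF B[rule_format, of i] n(3)] by (simp add: algebra_simps)
    with False show ?thesis unfolding computes_tree_in_iff
      using runs.intros(3)[OF False n(1)] n(2) by force
  qed
  then show ?thesis unfolding linear_time_def by blast
qed

text \<open>\<open>If\<close> can only test for \<open>Leaf\<close>. Comparison with the constant
  \<open>t\<close> is unrolled into nested tests along the shape of \<open>t\<close>, whose number
  does not depend on the input.\<close>

lemma linear_time_test:
  assumes "linear_time f" "linear_time g"
  shows "linear_time (\<lambda>i. if tree_val (input_state i) e = t then f i else g i)"
  using assms
proof (induction t arbitrary: e f)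
  case Leaf
  then show ?case using linear_time_if by simp
next
  case (Node a b)
  let ?v = "\<lambda>i. tree_val (input_state i)"
  \<comment> \<open>The test of \<open>e\<close> itself comes first: the children of
    \<open>Leaf\<close> are \<open>Leaf\<close> by default, so otherwise \<open>Leaf\<close> would
    pass for \<open>Node Leaf Leaf\<close>.\<close>
  have "linear_time (\<lambda>i. if ?v i e = Leaf then g i else if ?v i (Hd_exp e) = a
      then (if ?v i (Tl_exp e) = b then f i else g i) else g i)"
    by (intro linear_time_if Node)
  moreover have "(\<lambda>i. if ?v i e = Leaf then g i else if ?v i (Hd_exp e) = a
      then (if ?v i (Tl_exp e) = b then f i else g i) else g i) =
      (\<lambda>i. if ?v i e = Node a b then f i else g i)"
  proof
    show "(if ?v i e = Leaf then g i else if ?v i (Hd_exp e) = a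
      then (if ?v i (Tl_exp e) = b then f i else g i) else g i) =
      (if ?v i e = Node a b then f i else g i)" for i
      by (cases "?v i e") auto
  qed
  ultimately show ?case by simp
qed

text \<open>One comparison of the first component per element of \<open>S\<close>; injectivity of
  \<open>code\<close> keeps a new test from capturing older keys.\<close>

lemma linear_time_table:
  assumes "finite S" "inj_on code S" "\<And>x. x \<in> S \<Longrightarrow> linear_time (f x)"
  shows "\<exists>g. linear_time g \<and> (\<forall>x\<in>S. \<forall>t. g (Node (code x) t) = f x (Node (code x) t))"
  using assms
proof (induction S rule: finite_induct)
  case empty
  then show ?case using linear_time_val by blast
next
  case (insert x S)
  then obtain g where g: "linear_time g" "\<forall>x\<in>S. \<forall>t. g (Node (code x) t) = f x (Node (code x) t)"
    by auto
  let ?h = "\<lambda>i. if tree_val (input_state i) (Hd_exp (Var 0)) = code x then f x i else g i"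
  have "linear_time ?h" using linear_time_test insert.prems(2) g(1) by blast
  moreover have "\<forall>y\<in>insert x S. \<forall>t. ?h (Node (code y) t) = f y (Node (code y) t)"
    using g(2) insert.prems(1) insert.hyps(2) by (auto simp: inj_on_def)
  ultimately show ?case by blast
qed

section \<open>Applying a 3-cell to an encoded 2-path\<close>

primrec tree_const :: "tree \<Rightarrow> tree_exp" where
  "tree_const Leaf = Nil_exp"
| "tree_const (Node a b) = Cons_exp (tree_const a) (tree_const b)"

lemma tree_val_const [simp]: "tree_val s (tree_const t) = t"
  by (induction t) auto

text \<open>
  The 2-source has the same position in the code of every context, so that rewriting it only
  substitutes a constant there.
\<close>

definition replace_exp :: "tree \<Rightarrow> tree_exp" where
  "replace_exp t = (
    let a = Tl_exp (Var 0); m = Tl_exp (Tl_exp a); z = Hd_exp (Tl_exp m) in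
    Cons_exp (Hd_exp a) (Cons_exp (Hd_exp (Tl_exp a)) (Cons_exp (Hd_exp m)
      (Cons_exp (Cons_exp (Hd_exp z) (Cons_exp (Hd_exp (Tl_exp z))
        (Cons_exp (Hd_exp (Tl_exp (Tl_exp z)))
          (Cons_exp (tree_const t) (Tl_exp (Tl_exp (Tl_exp (Tl_exp z))))))))
        (Tl_exp (Tl_exp m))))))"

text \<open>In \<open>replace_exp\<close>, \<open>a\<close> is the code of the whole context,
  \<open>m\<close> that of what follows \<open>h\<close>, and \<open>z\<close> that of the layer
  between \<open>h\<close> and \<open>k\<close>.\<close>

lemma tree_val_replace_exp:
  "tree_val (input_state (Node i (code_expr (in_context h x a y k)))) (replace_exp (code_expr b)) =
    code_expr (in_context h x b y k)"
  by (simp add: replace_exp_def in_context_def Let_def)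

lemma code_nat_eq_iff [simp]: "code_nat m = code_nat n \<longleftrightarrow> m = n"
proof (induction m arbitrary: n)
  case 0
  then show ?case by (cases n) auto
next
  case (Suc m)
  then show ?case by (cases n) auto
qed

lemma inj_code_cell3: "inj code_cell3"
proof
  show "\<alpha> = \<beta>" if "code_cell3 \<alpha> = code_cell3 \<beta>" for \<alpha> \<beta>
    using that by (cases \<alpha>; cases \<beta>) (simp_all del: code_nat.simps)
qed

text \<open>One command serves all 3-cells because they are finitely many: it looks up the given
  cell and substitutes the code of its 2-target. The output is the rewritten context itself, so
  reflexivity settles the last condition.\<close>

lemma finite_program_polytime:
  assumes "finite_program P" "monoidal_3_polygraph (polygraph_of P)"
  shows "polytime_rewriting P"
proof -
  let ?G = "polygraph_of P"
  have "program_cells3 P = case_prod Perm_left ` (constrs P \<times> sorts P) \<union>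
     case_prod Perm_right ` (sorts P \<times> constrs P) \<union>
     Dupl_constr ` constrs P \<union> Eras_constr ` constrs P \<union> Computation ` rules P"
    by (auto simp: program_cells3_def)
  then have "finite (program_cells3 P)" using assms(1) by (simp add: finite_program_def)
  then have "finite (cells3 ?G)" by (simp add: polygraph_of_def)
  then obtain g where g: "linear_time g"
    "\<forall>\<alpha>\<in>cells3 ?G. \<forall>t. g (Node (code_cell3 \<alpha>) t) =
      tree_val (input_state (Node (code_cell3 \<alpha>) t)) (replace_exp (code_expr (tgt2 ?G \<alpha>)))"
    using linear_time_table[of "cells3 ?G" code_cell3
        "\<lambda>\<alpha> i. tree_val (input_state i) (replace_exp (code_expr (tgt2 ?G \<alpha>)))"]
      linear_time_val inj_on_subset[OF inj_code_cell3] by blast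
  obtain c B where c: "\<forall>i. \<exists>n. computes_tree_in c i n (g i) \<and> n \<le> B * tree_size i"
    using g(1) unfolding linear_time_def by blast
  have "\<exists>n b. computes_tree_in c i n (code_expr b) \<and> n \<le> poly (monom B 1) (tree_size i) \<and>
      same_path ?G b (in_context h x (tgt2 ?G \<alpha>) y k)"
    if "\<alpha> \<in> cells3 ?G" and typed: "has_type ?G (in_context h x (src2 ?G \<alpha>) y k) u v"
      and i: "i = Node (code_cell3 \<alpha>) (code_expr (in_context h x (src2 ?G \<alpha>) y k))"
    for \<alpha> h x y k u v i
  proof -
    interpret monoidal_polygraph ?G by standard (rule assms)
    obtain u' v' where "has_type ?G (src2 ?G \<alpha>) u' v'" "has_type ?G (tgt2 ?G \<alpha>) u' v'"
      using assms(2) \<open>\<alpha> \<in> cells3 ?G\<close> unfolding monoidal_3_polygraph_def by blast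
    then have "well_typed (in_context h x (tgt2 ?G \<alpha>) y k)"
      using typed by (auto simp: has_type_iff in_context_def)
    then have "same_path ?G (in_context h x (tgt2 ?G \<alpha>) y k) (in_context h x (tgt2 ?G \<alpha>) y k)"
      by (rule eqv_refl)
    moreover have "g i = code_expr (in_context h x (tgt2 ?G \<alpha>) y k)"
      using g(2) that(1) by (simp add: i tree_val_replace_exp)
    ultimately show ?thesis using c[rule_format, of i] by (auto simp: poly_monom)
  qed
  then show ?thesis unfolding polytime_rewriting_def Let_def by blast
qed

section \<open>Typing of programs\<close>

text \<open>The types are tied by equations because the goals give them as explicit lists, in which
  unification finds no concatenation.\<close>

lemma comp0_type: "has_type G a u v \<Longrightarrow> has_type G b u' v' \<Longrightarrow> w = u @ u' \<Longrightarrow> w' = v @ v' \<Longrightarrow>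
    has_type G (a \<star>\<^sub>0 b) w w'"
  by (simp add: has_type.intros)

context
  fixes P :: "('s, 'k, 'f, 'r) program"
  assumes constrs_typed: "\<And>\<gamma>. \<gamma> \<in> constrs P \<Longrightarrow> set (constr_src P \<gamma>) \<subseteq> sorts P \<and> constr_tgt P \<gamma> \<in> sorts P"
    and funs_typed: "\<And>\<phi>. \<phi> \<in> funs P \<Longrightarrow> set (fun_src P \<phi>) \<subseteq> sorts P \<and> set (fun_tgt P \<phi>) \<subseteq> sorts P"
    and rules_typed: "\<And>r. r \<in> rules P \<Longrightarrow> \<exists>u v. has_type (polygraph_of P) (rule_src P r) u v \<and>
      has_type (polygraph_of P) (rule_tgt P r) u v"
begin

private lemma path_type: "set u \<subseteq> sorts P \<Longrightarrow> has_type (polygraph_of P) (Path u) u u"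
  by (rule has_type.intros) (simp add: polygraph_of_def)

private lemma cell_type: "c \<in> program_cells2 P \<Longrightarrow> u = program_src1 P c \<Longrightarrow> v = program_tgt1 P c \<Longrightarrow>
    has_type (polygraph_of P) (Cell c) u v"
  using has_type.intros(2)[of c "polygraph_of P"] by (simp add: polygraph_of_def)

private lemma perm_word_type:
  "set x \<subseteq> sorts P \<Longrightarrow> \<zeta> \<in> sorts P \<Longrightarrow> has_type (polygraph_of P) (perm_word x \<zeta>) (x @ [\<zeta>]) (\<zeta> # x)"
proof (induction x)
  case (Cons \<xi> x)
  show ?case unfolding perm_word.simps
    by (rule has_type.intros(4), rule comp0_type[OF path_type Cons.IH], use Cons.prems in simp_all,
        rule comp0_type[OF cell_type path_type], use Cons.prems in \<open>auto simp: program_cells2_def\<close>)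
qed (simp add: path_type)

private lemma perm_sort_type:
  "set x \<subseteq> sorts P \<Longrightarrow> \<zeta> \<in> sorts P \<Longrightarrow> has_type (polygraph_of P) (perm_sort \<zeta> x) (\<zeta> # x) (x @ [\<zeta>])"
proof (induction x)
  case (Cons \<xi> x)
  show ?case unfolding perm_sort.simps
    by (rule has_type.intros(4), rule comp0_type[OF cell_type path_type, OF _ HOL.refl HOL.refl],
        use Cons.prems in \<open>auto simp: program_cells2_def\<close>,
        rule comp0_type[OF path_type Cons.IH], use Cons.prems in auto)
qed (simp add: path_type)

private lemma dupl_word_type:
  "set x \<subseteq> sorts P \<Longrightarrow> has_type (polygraph_of P) (dupl_word x) x (x @ x)"
proof (induction x)
  case (Cons \<xi> x)
  have "has_type (polygraph_of P) (Cell (Dupl \<xi>) \<star>\<^sub>0 dupl_word x) (\<xi> # x) (\<xi> # \<xi> # x @ x)"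
    by (rule comp0_type[OF cell_type Cons.IH]) (use Cons.prems in \<open>auto simp: program_cells2_def\<close>)
  moreover have "has_type (polygraph_of P) (perm_sort \<xi> x \<star>\<^sub>0 Path x) (\<xi> # x @ x) (x @ \<xi> # x)"
    by (rule comp0_type[OF perm_sort_type path_type]) (use Cons.prems in auto)
  from comp0_type[OF path_type[of "[\<xi>]"] this]
  have "has_type (polygraph_of P) (Path [\<xi>] \<star>\<^sub>0 perm_sort \<xi> x \<star>\<^sub>0 Path x)
      (\<xi> # \<xi> # x @ x) ((\<xi> # x) @ \<xi> # x)"
    using Cons.prems by simp
  ultimately show ?case unfolding dupl_word.simps by (rule has_type.intros)
qed (simp add: path_type)

private lemma eras_word_type:
  "set x \<subseteq> sorts P \<Longrightarrow> has_type (polygraph_of P) (eras_word x) x []"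
proof (induction x)
  case (Cons \<xi> x)
  show ?case unfolding eras_word.simps
    by (rule comp0_type[OF cell_type Cons.IH]) (use Cons.prems in \<open>auto simp: program_cells2_def\<close>)
qed (simp add: path_type)

lemma program_monoidal: "monoidal_3_polygraph (polygraph_of P)"
proof -
  have cells: "set (program_src1 P c) \<subseteq> sorts P \<and> set (program_tgt1 P c) \<subseteq> sorts P"
    if "c \<in> program_cells2 P" for c
    using that constrs_typed funs_typed by (cases c) (auto simp: program_cells2_def subset_iff)
  have left: "\<exists>u v. has_type (polygraph_of P) (program_src2 P (Perm_left \<gamma> \<zeta>)) u v \<and>
      has_type (polygraph_of P) (program_tgt2 P (Perm_left \<gamma> \<zeta>)) u v"
    if \<gamma>: "\<gamma> \<in> constrs P" and \<zeta>: "\<zeta> \<in> sorts P" for \<gamma> \<zeta>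
  proof (intro exI conjI)
    show "has_type (polygraph_of P) (program_src2 P (Perm_left \<gamma> \<zeta>))
      (constr_src P \<gamma> @ [\<zeta>]) [\<zeta>, constr_tgt P \<gamma>]"
      unfolding program_src2.simps
      by (rule has_type.intros(4), rule comp0_type[OF cell_type path_type, OF _ HOL.refl HOL.refl],
          use \<gamma> \<zeta> constrs_typed in \<open>auto simp: program_cells2_def intro!: cell_type\<close>)
    show "has_type (polygraph_of P) (program_tgt2 P (Perm_left \<gamma> \<zeta>))
      (constr_src P \<gamma> @ [\<zeta>]) [\<zeta>, constr_tgt P \<gamma>]"
      unfolding program_tgt2.simps
      by (rule has_type.intros(4)[OF perm_word_type], use \<gamma> \<zeta> constrs_typed in auto,
          rule comp0_type[OF path_type cell_type, OF _ _ HOL.refl HOL.refl],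
          use \<gamma> \<zeta> constrs_typed in \<open>auto simp: program_cells2_def\<close>)
  qed
  have right: "\<exists>u v. has_type (polygraph_of P) (program_src2 P (Perm_right \<zeta> \<gamma>)) u v \<and>
      has_type (polygraph_of P) (program_tgt2 P (Perm_right \<zeta> \<gamma>)) u v"
    if \<gamma>: "\<gamma> \<in> constrs P" and \<zeta>: "\<zeta> \<in> sorts P" for \<gamma> \<zeta>
  proof (intro exI conjI)
    show "has_type (polygraph_of P) (program_src2 P (Perm_right \<zeta> \<gamma>))
      (\<zeta> # constr_src P \<gamma>) [constr_tgt P \<gamma>, \<zeta>]"
      unfolding program_src2.simps
      by (rule has_type.intros(4), rule comp0_type[OF path_type cell_type, OF _ _ HOL.refl HOL.refl],
          use \<gamma> \<zeta> constrs_typed in \<open>auto simp: program_cells2_def intro!: cell_type\<close>)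
    show "has_type (polygraph_of P) (program_tgt2 P (Perm_right \<zeta> \<gamma>))
      (\<zeta> # constr_src P \<gamma>) [constr_tgt P \<gamma>, \<zeta>]"
      unfolding program_tgt2.simps
      by (rule has_type.intros(4)[OF perm_sort_type], use \<gamma> \<zeta> constrs_typed in auto,
          rule comp0_type[OF cell_type path_type, OF _ HOL.refl HOL.refl],
          use \<gamma> \<zeta> constrs_typed in \<open>auto simp: program_cells2_def\<close>)
  qed
  have dupl: "\<exists>u v. has_type (polygraph_of P) (program_src2 P (Dupl_constr \<gamma>)) u v \<and>
      has_type (polygraph_of P) (program_tgt2 P (Dupl_constr \<gamma>)) u v"
    if \<gamma>: "\<gamma> \<in> constrs P" for \<gamma>
  proof (intro exI conjI)
    show "has_type (polygraph_of P) (program_src2 P (Dupl_constr \<gamma>))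
      (constr_src P \<gamma>) [constr_tgt P \<gamma>, constr_tgt P \<gamma>]"
      unfolding program_src2.simps
      by (rule has_type.intros(4)[OF cell_type cell_type])
        (use \<gamma> constrs_typed in \<open>auto simp: program_cells2_def\<close>)
    show "has_type (polygraph_of P) (program_tgt2 P (Dupl_constr \<gamma>))
      (constr_src P \<gamma>) [constr_tgt P \<gamma>, constr_tgt P \<gamma>]"
      unfolding program_tgt2.simps
      by (rule has_type.intros(4)[OF dupl_word_type], use \<gamma> constrs_typed in auto,
          rule comp0_type[OF cell_type cell_type, OF _ HOL.refl HOL.refl _ HOL.refl HOL.refl],
          use \<gamma> constrs_typed in \<open>auto simp: program_cells2_def\<close>)
  qed
  have eras: "\<exists>u v. has_type (polygraph_of P) (program_src2 P (Eras_constr \<gamma>)) u v \<and>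
      has_type (polygraph_of P) (program_tgt2 P (Eras_constr \<gamma>)) u v"
    if \<gamma>: "\<gamma> \<in> constrs P" for \<gamma>
  proof (intro exI conjI)
    show "has_type (polygraph_of P) (program_src2 P (Eras_constr \<gamma>)) (constr_src P \<gamma>) []"
      unfolding program_src2.simps
      by (rule has_type.intros(4)[OF cell_type cell_type])
        (use \<gamma> constrs_typed in \<open>auto simp: program_cells2_def\<close>)
    show "has_type (polygraph_of P) (program_tgt2 P (Eras_constr \<gamma>)) (constr_src P \<gamma>) []"
      unfolding program_tgt2.simps using eras_word_type \<gamma> constrs_typed by blast
  qed
  have "\<exists>u v. has_type (polygraph_of P) (program_src2 P \<alpha>) u v \<and>
      has_type (polygraph_of P) (program_tgt2 P \<alpha>) u v" if "\<alpha> \<in> program_cells3 P" for \<alpha>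
    using that left right dupl eras rules_typed unfolding program_cells3_def by fastforce
  with cells show ?thesis
    unfolding monoidal_3_polygraph_def by (auto simp: polygraph_of_def)
qed

end

section \<open>Programs as string rewriting systems\<close>

text \<open>Rules are restricted so that words suffice: a left-hand side is a pair of adjacent
  letters, one constructor and one function, and a right-hand side without structure 2-cells keeps
  the class of words closed under rewriting.\<close>

locale linear_program =
  fixes P :: "('s, 'k, 'f, 'r) program"
    and lhs_constr :: "'r \<Rightarrow> 'k" and lhs_fun :: "'r \<Rightarrow> 'f" and rhs :: "'r \<Rightarrow> ('s, 'k, 'f) cell2 list"
  assumes constrs_linear: "\<And>\<gamma>. \<gamma> \<in> constrs P \<Longrightarrow>
      set (constr_src P \<gamma>) \<subseteq> sorts P \<and> constr_tgt P \<gamma> \<in> sorts P \<and> length (constr_src P \<gamma>) \<le> 1"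
    and funs_linear: "\<And>\<phi>. \<phi> \<in> funs P \<Longrightarrow>
      set (fun_src P \<phi>) \<subseteq> sorts P \<and> set (fun_tgt P \<phi>) \<subseteq> sorts P \<and>
      length (fun_src P \<phi>) = 1 \<and> length (fun_tgt P \<phi>) = 1"
    and rules_linear: "\<And>r. r \<in> rules P \<Longrightarrow>
      rule_src P r = Cell (Constr (lhs_constr r)) \<star>\<^sub>1 Cell (Fun (lhs_fun r)) \<and>
      rule_tgt P r = comp_word (constr_src P (lhs_constr r)) (rhs r) \<and>
      lhs_constr r \<in> constrs P \<and> lhs_fun r \<in> funs P \<and>
      fun_src P (lhs_fun r) = [constr_tgt P (lhs_constr r)] \<and>
      chain (polygraph_of P) (constr_src P (lhs_constr r)) (rhs r) (fun_tgt P (lhs_fun r)) \<and>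
      set (rhs r) \<subseteq> range Constr \<union> range Fun"
begin

abbreviation "G \<equiv> polygraph_of P"

lemma polygraph_of_simps [simp]:
  "cells1 G = sorts P" "cells2 G = program_cells2 P" "src1 G = program_src1 P" "tgt1 G = program_tgt1 P"
  "cells3 G = program_cells3 P" "src2 G = program_src2 P" "tgt2 G = program_tgt2 P"
  by (simp_all add: polygraph_of_def)

lemma cells2_iff [simp]: "Constr \<gamma> \<in> program_cells2 P \<longleftrightarrow> \<gamma> \<in> constrs P"
  "Fun \<phi> \<in> program_cells2 P \<longleftrightarrow> \<phi> \<in> funs P"
  by (auto simp: program_cells2_def)

lemma rule_src_type: "r \<in> rules P \<Longrightarrow>
    has_type G (rule_src P r) (constr_src P (lhs_constr r)) (fun_tgt P (lhs_fun r))"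
  using rules_linear[of r] has_type.intros(2)[of "Constr (lhs_constr r)" G]
    has_type.intros(2)[of "Fun (lhs_fun r)" G] by (auto intro: has_type.intros)

lemma rule_tgt_type: "r \<in> rules P \<Longrightarrow>
    has_type G (rule_tgt P r) (constr_src P (lhs_constr r)) (fun_tgt P (lhs_fun r))"
  using rules_linear comp_word_type by metis

sublocale monoidal_polygraph G
proof
  show "monoidal_3_polygraph G"
    by (rule program_monoidal)
      (use constrs_linear funs_linear rule_src_type rule_tgt_type in blast)+
qed

notation eqv (infix "\<approx>" 50)

lemma linear_cell: "c \<in> program_cells2 P \<Longrightarrow> c \<in> range Constr \<union> range Fun \<Longrightarrow> linear c"
  using constrs_linear funs_linear by (auto simp: linear_def)

lemma linear_cells:
  "well_typed a \<Longrightarrow> set (cells_of a) \<subseteq> range Constr \<union> range Fun \<Longrightarrow> \<forall>c\<in>set (cells_of a). linear c"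
  by (induction a) (auto intro: linear_cell)

lemma linear_chain: "chain G u w v \<Longrightarrow> set w \<subseteq> range Constr \<union> range Fun \<Longrightarrow> \<forall>c\<in>set w. linear c"
  using linear_cells[of "comp_word u w"] comp_word_typed by simp

lemma eqv_comp_word:
  assumes "has_type G a [] [s]" "set (cells_of a) \<subseteq> range Constr \<union> range Fun" "trace a [] = [w]"
  shows "a \<approx> comp_word [] w" "chain G [] w [s]" "set w = set (cells_of a)"
proof -
  have "\<forall>c\<in>set (cells_of a). linear c" using linear_cells assms has_type_iff by metis
  then show "a \<approx> comp_word [] w" "chain G [] w [s]" "set w = set (cells_of a)"
    using closed_linear_word[OF assms(1)] assms(3) by (metis list.inject)+
qed

text \<open>\<open>concat\<close> makes the formula uniform: an empty word returns the wires of
  \<open>ws\<close> unchanged, a nonempty one merges them into one.\<close>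

lemma concat_trace_comp_word:
  "\<forall>c\<in>set w. linear c \<Longrightarrow> concat (trace (comp_word u w) ws) = w @ concat ws"
  by (cases w) (auto simp: linear_def trace_comp_word simp del: comp_word.simps(2))

lemma concat_trace_rule:
  assumes "r \<in> rules P"
  shows "concat (trace (rule_src P r) ws) = Fun (lhs_fun r) # Constr (lhs_constr r) # concat ws"
    and "concat (trace (rule_tgt P r) ws) = rhs r @ concat ws"
proof -
  note r = rules_linear[OF assms]
  show "concat (trace (rule_src P r) ws) = Fun (lhs_fun r) # Constr (lhs_constr r) # concat ws"
    using r funs_linear by simp
  show "concat (trace (rule_tgt P r) ws) = rhs r @ concat ws"
    using r concat_trace_comp_word linear_chain by metis
qed

lemma cells_of_rule:
  assumes "r \<in> rules P"
  shows "set (cells_of (rule_src P r)) \<subseteq> range Constr \<union> range Fun"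
    and "set (cells_of (rule_tgt P r)) \<subseteq> range Constr \<union> range Fun"
  using rules_linear[OF assms] by auto

text \<open>Closed 2-paths of linear cells have a single wire, so that rewriting contexts are words.\<close>

lemma rewrite_step_cases:
  assumes w: "chain G [] w [s]" "set w \<subseteq> range Constr \<union> range Fun"
    and step: "rewrite_step G (path2_of G (comp_word [] w)) Y"
  obtains r p z where "r \<in> rules P" "w = p @ Fun (lhs_fun r) # Constr (lhs_constr r) # z"
    "Y = path2_of G (comp_word [] (p @ rhs r @ z))"
proof -
  obtain h x \<alpha> y k u v where \<alpha>: "\<alpha> \<in> program_cells3 P"
    and X: "has_type G (in_context h x (program_src2 P \<alpha>) y k) u v"
      "path2_of G (comp_word [] w) = path2_of G (in_context h x (program_src2 P \<alpha>) y k)"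
    and Y: "Y = path2_of G (in_context h x (program_tgt2 P \<alpha>) y k)"
    using step unfolding rewrite_step_def by auto
  have eqv: "comp_word [] w \<approx> in_context h x (program_src2 P \<alpha>) y k"
    using X(2) path2_of_eq_iff comp_word_typed[OF w(1)] by blast
  \<comment> \<open>All representatives contain the same cells, and every structure 3-cell has a
    structure 2-cell in its 2-source, so only a computation 3-cell can apply.\<close>
  have cells: "set (cells_of (in_context h x (program_src2 P \<alpha>) y k)) = set w"
    using same_path_cells[OF eqv] by simp
  then have "set (cells_of (program_src2 P \<alpha>)) \<subseteq> range Constr \<union> range Fun"
    using w(2) by (auto simp: in_context_def)
  then obtain r where r: "\<alpha> = Computation r" "r \<in> rules P"
    using \<alpha> by (auto simp: program_cells3_def)
  note rule = rules_linear[OF r(2)]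
  have X_type: "has_type G (in_context h x (rule_src P r) y k) [] [s]"
    using same_path_typed[OF eqv] comp_word_typed[OF w(1)] X(1) r(1) by (simp add: has_type_iff)
  have src_type: "well_typed (rule_src P r)" "dom1 (rule_src P r) = constr_src P (lhs_constr r)"
      "cod1 (rule_src P r) = fun_tgt P (lhs_fun r)"
    and tgt_type: "well_typed (rule_tgt P r)" "dom1 (rule_tgt P r) = constr_src P (lhs_constr r)"
      "cod1 (rule_tgt P r) = fun_tgt P (lhs_fun r)"
    using rule_src_type[OF r(2)] rule_tgt_type[OF r(2)] by (auto simp: has_type_iff)
  have Y_type: "has_type G (in_context h x (rule_tgt P r) y k) [] [s]"
    using X_type src_type tgt_type by (simp add: has_type_iff in_context_def)
  have hk: "well_typed h" "well_typed k" "dom1 h = []" "cod1 k = [s]"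
      "cod1 h = x @ constr_src P (lhs_constr r) @ y" "dom1 k = x @ fun_tgt P (lhs_fun r) @ y"
    using X_type src_type by (auto simp: has_type_iff in_context_def)
  have cells_hk: "set (cells_of h) \<subseteq> range Constr \<union> range Fun" "set (cells_of k) \<subseteq> range Constr \<union> range Fun"
    using cells w(2) by (auto simp: in_context_def)
  have k: "\<forall>c\<in>set (cells_of k). linear c"
    using linear_cells hk(2) cells_hk(2) by blast
  have len: "length (fun_tgt P (lhs_fun r)) = 1" using rule funs_linear by blast
  \<comment> \<open>The part \<open>k\<close> after the redex ends in one wire and never loses
    wires. The redex already feeds one into it, leaving none for \<open>x\<close> and
    \<open>y\<close>.\<close>
  have "length x + length (fun_tgt P (lhs_fun r)) + length y \<le> 1"
    using linear_dom_le_cod[OF hk(2) k] hk(4,6) by simp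
  then have xy: "x = []" "y = []" using len by auto
  then have "length (dom1 k) = length (cod1 k)" using hk len by simp
  \<comment> \<open>With one input and one output, \<open>k\<close> has no nullary cell and merely
    prepends a fixed word \<open>p\<close>.\<close>
  then obtain ps where ps: "length ps = length (dom1 k)"
    "\<forall>ws. length ws = length (dom1 k) \<longrightarrow> trace k ws = map2 (@) ps ws"
    using trace_prepends[OF hk(2) k] by blast
  then obtain p where p: "ps = [p]" using hk(6) xy len by (auto simp: length_Suc_conv)
  have trace_k: "trace k ws = [p @ concat ws]" if "length ws = 1" for ws
  proof -
    have "trace k ws = map2 (@) ps ws" using ps(2) that hk(6) xy len by simp
    then show ?thesis using p that by (auto simp: length_Suc_conv)
  qed
  \<comment> \<open>The words that \<open>h\<close> delivers to the redex: one for a unary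
    constructor, none for a nullary one. In both cases \<open>concat ?H\<close> is the wanted
    \<open>z\<close>.\<close>
  let ?H = "trace h []"
  have H: "length ?H = length (constr_src P (lhs_constr r))"
    using length_trace[OF hk(1), of "[]"] hk(3,5) xy by simp
  have src: "trace (in_context h x (rule_src P r) y k) [] =
      [p @ Fun (lhs_fun r) # Constr (lhs_constr r) # concat ?H]"
    using trace_k[of "trace (rule_src P r) ?H"] length_trace[OF src_type(1), of ?H] H src_type len
      concat_trace_rule[OF r(2)] by (simp add: in_context_def xy)
  have tgt: "trace (in_context h x (rule_tgt P r) y k) [] = [p @ rhs r @ concat ?H]"
    using trace_k[of "trace (rule_tgt P r) ?H"] length_trace[OF tgt_type(1), of ?H] H tgt_type len
      concat_trace_rule[OF r(2)] by (simp add: in_context_def xy)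
  \<comment> \<open>Equivalent expressions have equal traces, and that of
    \<open>comp_word [] w\<close> is \<open>w\<close> alone, which yields the decomposition of
    \<open>w\<close>.\<close>
  have "trace (comp_word [] w) [] = [p @ Fun (lhs_fun r) # Constr (lhs_constr r) # concat ?H]"
    using trace_same_path[OF eqv, of "[]"] src r(1) by simp
  moreover have "w \<noteq> []" using w(1) by auto
  ultimately have w_eq: "w = p @ Fun (lhs_fun r) # Constr (lhs_constr r) # concat ?H"
    using trace_comp_word[of w "[]" "[]"] linear_chain[OF w] by simp
  have "set (cells_of (in_context h x (rule_tgt P r) y k)) \<subseteq> range Constr \<union> range Fun"
    using cells_hk cells_of_rule[OF r(2)] by (simp add: in_context_def)
  then have "in_context h x (rule_tgt P r) y k \<approx> comp_word [] (p @ rhs r @ concat ?H)"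
    using eqv_comp_word[OF Y_type _ tgt] by blast
  then have "Y = path2_of G (comp_word [] (p @ rhs r @ concat ?H))"
    using Y r(1) path2_of_eqI by simp
  with that r(2) w_eq show thesis by blast
qed

lemma rewrite_stepI:
  assumes r: "r \<in> rules P"
    and w: "chain G [] (p @ Fun (lhs_fun r) # Constr (lhs_constr r) # z) [s]"
      "set (p @ Fun (lhs_fun r) # Constr (lhs_constr r) # z) \<subseteq> range Constr \<union> range Fun"
  shows "rewrite_step G (path2_of G (comp_word [] (p @ Fun (lhs_fun r) # Constr (lhs_constr r) # z)))
      (path2_of G (comp_word [] (p @ rhs r @ z)))"
    and "chain G [] (p @ rhs r @ z) [s]"
proof -
  note rule = rules_linear[OF r]
  \<comment> \<open>The cells before the redex and those after it are the two halves of a context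
    without side wires.\<close>
  let ?h = "comp_word [] z" and ?k = "comp_word (fun_tgt P (lhs_fun r)) p"
  have z: "chain G [] z (constr_src P (lhs_constr r))" and p: "chain G (fun_tgt P (lhs_fun r)) p [s]"
    using w(1) by (auto simp: chain_append)
  have p_linear: "\<forall>c\<in>set p. linear c" and z_linear: "\<forall>c\<in>set z. linear c"
    using linear_chain[OF p] linear_chain[OF z] w(2) by auto
  have src_type: "has_type G (in_context ?h [] (rule_src P r) [] ?k) [] [s]"
    and tgt_type: "has_type G (in_context ?h [] (rule_tgt P r) [] ?k) [] [s]"
    using comp_word_typed[OF z] comp_word_typed[OF p] rule_src_type[OF r] rule_tgt_type[OF r]
    by (auto simp: in_context_def has_type_iff)
  have "length (trace ?h []) = length (constr_src P (lhs_constr r))"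
    using length_trace comp_word_typed[OF z] by simp
  then have concat_src: "concat (trace (in_context ?h [] (rule_src P r) [] ?k) []) =
      p @ Fun (lhs_fun r) # Constr (lhs_constr r) # z"
    and concat_tgt: "concat (trace (in_context ?h [] (rule_tgt P r) [] ?k) []) = p @ rhs r @ z"
    using rule_src_type[OF r] rule_tgt_type[OF r] concat_trace_rule[OF r]
      concat_trace_comp_word[OF p_linear] concat_trace_comp_word[OF z_linear]
    by (auto simp: in_context_def has_type_iff)
  \<comment> \<open>Such an expression ends in one wire, so \<open>concat\<close> loses
    nothing.\<close>
  have single: "trace a [] = [concat (trace a [])]" if "has_type G a [] [s]" for a
  proof -
    have "cod1 a = [s]" "well_typed a" "dom1 a = []" using that by (auto simp: has_type_iff)
    then have "length (trace a []) = 1" using length_trace[of a "[]"] by simp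
    then show ?thesis by (auto simp: length_Suc_conv)
  qed
  have src: "in_context ?h [] (rule_src P r) [] ?k \<approx>
      comp_word [] (p @ Fun (lhs_fun r) # Constr (lhs_constr r) # z)"
    using eqv_comp_word(1)[OF src_type _ single[OF src_type]] concat_src cells_of_rule[OF r] w(2)
    by (simp add: in_context_def)
  have tgt: "in_context ?h [] (rule_tgt P r) [] ?k \<approx> comp_word [] (p @ rhs r @ z)"
    and "chain G [] (p @ rhs r @ z) [s]"
    using eqv_comp_word(1,2)[OF tgt_type _ single[OF tgt_type]] concat_tgt cells_of_rule[OF r] w(2)
    by (simp_all add: in_context_def)
  then show "chain G [] (p @ rhs r @ z) [s]" by simp
  have "Computation r \<in> cells3 G" using r by (simp add: program_cells3_def)
  with src_type show "rewrite_step G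
      (path2_of G (comp_word [] (p @ Fun (lhs_fun r) # Constr (lhs_constr r) # z)))
      (path2_of G (comp_word [] (p @ rhs r @ z)))"
    unfolding rewrite_step_def path2_of_eqI[OF src, symmetric] path2_of_eqI[OF tgt, symmetric]
    by (metis polygraph_of_simps(6,7) program_src2.simps(5) program_tgt2.simps(5))
qed

end

section \<open>Deterministic relations\<close>

text \<open>Every run from \<open>x\<close> follows the one that leads to the irreducible
  \<open>z\<close>; so \<open>y\<close> lies on the way, with at most \<open>n\<close> steps
  remaining.\<close>

lemma deterministic_relpowp_rtranclp:
  assumes "right_unique step" and "\<nexists>y. step z y"
  shows "step\<^sup>*\<^sup>* x y \<Longrightarrow> (step ^^ n) x z \<Longrightarrow> \<exists>m\<le>n. (step ^^ m) y z"
proof (induction arbitrary: n rule: converse_rtranclp_induct)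
  case (step x x')
  then obtain n' where "n = Suc n'" "(step ^^ n') x' z"
    using assms by (metis relpowp_E2 right_uniqueD)
  then show ?case using step.IH by (metis le_Suc_eq)
qed auto

lemma deterministic_rtranclp:
  assumes "right_unique step" "\<nexists>y. step z y" "step\<^sup>*\<^sup>* x y" "step\<^sup>*\<^sup>* x z"
  shows "step\<^sup>*\<^sup>* y z"
  using deterministic_relpowp_rtranclp[OF assms(1,2,3)] assms(4) by (metis rtranclp_power)

text \<open>At least one step has been made, so strictly fewer remain. This is the decreasing
  quantity when a run of the machine is recovered from a run of the stacks.\<close>

lemma deterministic_tranclp:
  assumes "right_unique step" and "\<nexists>y. step z y"
    and "step\<^sup>+\<^sup>+ x y" "(step ^^ n) x z"
  shows "\<exists>m<n. (step ^^ m) y z"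
proof -
  obtain x' where x': "step x x'" "step\<^sup>*\<^sup>* x' y" using assms(3) by (metis tranclpD)
  then obtain n' where "n = Suc n'" "(step ^^ n') x' z"
    using assms by (metis relpowp_E2 right_uniqueD)
  then show ?thesis using deterministic_relpowp_rtranclp[OF assms(1,2) x'(2)]
    by (metis less_Suc_eq_le)
qed

section \<open>Simulating a Turing machine\<close>

text \<open>
  Sort 0 represents words and sort 1 the tape to the right of the head; the tape to the left is
  kept in the functions that follow the head. \<open>Back\<close> and \<open>Drop\<close> are markers: a function can
  only be consumed by a constructor that reaches it.
\<close>

datatype ('q, 'a) tm_constr =
  Empty | Letter 'a | Bottom | Symbol 'a | Back 'q | Drop

text \<open>\<open>Push c\<close> is an output that has to wait. The constructor \<open>c\<close>
  placed after a function still at work would create a second place where a constructor meets a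
  function. As a function it is released only when a constructor reaches it, so all constructors
  stay before all functions.\<close>

datatype ('q, 'a) tm_fun =
  Start | Head 'q | Below 'a | Finish | Push "('q, 'a) tm_constr" | Collect | Clear

primrec tm_constr_src :: "('q, 'a) tm_constr \<Rightarrow> nat list" where
  "tm_constr_src Empty = []"
| "tm_constr_src (Letter a) = [0]"
| "tm_constr_src Bottom = []"
| "tm_constr_src (Symbol a) = [1]"
| "tm_constr_src (Back q) = [1]"
| "tm_constr_src Drop = [1]"

primrec tm_constr_tgt :: "('q, 'a) tm_constr \<Rightarrow> nat" where
  "tm_constr_tgt Empty = 0"
| "tm_constr_tgt (Letter a) = 0"
| "tm_constr_tgt Bottom = 1"
| "tm_constr_tgt (Symbol a) = 1"
| "tm_constr_tgt (Back q) = 1"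
| "tm_constr_tgt Drop = 1"

primrec tm_fun_src :: "('q, 'a) tm_fun \<Rightarrow> nat" where
  "tm_fun_src Start = 0"
| "tm_fun_src (Head q) = 1"
| "tm_fun_src (Below a) = 1"
| "tm_fun_src Finish = 1"
| "tm_fun_src (Push k) = tm_constr_tgt k"
| "tm_fun_src Collect = 1"
| "tm_fun_src Clear = 1"

primrec tm_fun_tgt :: "('q, 'a) tm_fun \<Rightarrow> nat" where
  "tm_fun_tgt Start = 1"
| "tm_fun_tgt (Head q) = 1"
| "tm_fun_tgt (Below a) = 1"
| "tm_fun_tgt Finish = 0"
| "tm_fun_tgt (Push k) = tm_constr_tgt k"
| "tm_fun_tgt Collect = 0"
| "tm_fun_tgt Clear = 0"

definition tm_constrs :: "('q, 'a) tm \<Rightarrow> ('q, 'a) tm_constr set" where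
  "tm_constrs M = {Empty, Bottom, Drop} \<union> Letter ` input_alphabet M \<union>
     Symbol ` tape_alphabet M \<union> Back ` states M"

text \<open>Only letters and symbols are pushed: their input and output sorts agree, which gives
  \<open>Push\<close> its type.\<close>

definition tm_funs :: "('q, 'a) tm \<Rightarrow> ('q, 'a) tm_fun set" where
  "tm_funs M = {Start, Finish, Collect, Clear} \<union> Head ` states M \<union> Below ` tape_alphabet M \<union>
     (\<lambda>a. Push (Letter a)) ` input_alphabet M \<union> (\<lambda>a. Push (Symbol a)) ` tape_alphabet M"

text \<open>\<open>base\<close> is what stays under the symbol read: nothing if the symbol came from
  the stack, \<open>Bottom\<close> if it is a blank read beyond the end. A left move needs the
  symbol held by the next function, which no rule for \<open>Head\<close> can see; so it leaves the
  constructor \<open>Back q'\<close> to meet that function.\<close>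

definition move :: "('q, 'a) tm \<Rightarrow> 'q \<Rightarrow> 'a \<Rightarrow> ('q, 'a) tm_constr list
    \<Rightarrow> ('q, 'a) tm_constr list \<times> ('q, 'a) tm_fun list" where
  "move M q a base = (case delta M q a of
     (q', b, L) \<Rightarrow> (Back q' # Symbol b # base, [])
   | (q', b, R) \<Rightarrow> (base, [Head q', Below b]))"

text \<open>
  The entry for a constructor and the function below it is what replaces them: constructors
  listed bottom up and functions listed top down, both starting at the boundary between the two.
\<close>

fun table :: "('q, 'a) tm \<Rightarrow> ('q, 'a) tm_constr \<Rightarrow> ('q, 'a) tm_fun
    \<Rightarrow> (('q, 'a) tm_constr list \<times> ('q, 'a) tm_fun list) option" where
  "table M k (Push c) = Some ([c, k], [])"
| "table M Empty Start = Some ([Bottom], [])"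
| "table M (Letter a) Start = Some ([], [Start, Push (Symbol a)])"
| "table M (Symbol a) (Head q) =
     Some (if q \<in> halting M then ([Drop, Symbol a], []) else move M q a [])"
| "table M Bottom (Head q) =
     Some (if q \<in> halting M then ([Drop, Bottom], []) else move M q (blank M) [Bottom])"
| "table M (Back q) (Below a) = Some ([Symbol a], [Head q])"
| "table M (Back q) Finish = Some ([Symbol (blank M)], [Head q, Finish])"
| "table M Drop (Below a) = Some ([Drop], [])"
| "table M Drop Finish = Some ([], [Collect])"
| "table M (Symbol a) Collect =
     (if a = blank M then Some ([], [Clear])
      else if a \<in> input_alphabet M then Some ([], [Collect, Push (Letter a)]) else None)"
| "table M Bottom Collect = Some ([Empty], [])"
| "table M (Symbol a) Clear = Some ([], [Clear])"
| "table M Bottom Clear = Some ([Empty], [])"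
| "table M _ _ = None"

type_synonym ('q, 'a) stacks = "('q, 'a) tm_constr list \<times> ('q, 'a) tm_fun list"

inductive stack_step :: "('q, 'a) tm \<Rightarrow> ('q, 'a) stacks \<Rightarrow> ('q, 'a) stacks \<Rightarrow> bool" for M where
  "table M k \<phi> = Some (ls, gs) \<Longrightarrow> stack_step M (k # ks, \<phi> # fs) (ls @ ks, gs @ fs)"

lemma right_unique_stack_step: "right_unique (stack_step M)"
  by (rule right_uniqueI) (auto elim!: stack_step.cases)

lemma stack_stepI:
  "table M k \<phi> = Some (ls, gs) \<Longrightarrow> c = (ls @ ks, gs @ fs) \<Longrightarrow> stack_step M (k # ks, \<phi> # fs) c"
  by (simp add: stack_step.intros)

section \<open>Loading the input and collecting the output\<close>

text \<open>\<open>Push\<close> fires only on a constructor, hence the nonempty stack. Each release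
  covers the previous one, which reverses the list.\<close>

lemma push_steps:
  "ks \<noteq> [] \<Longrightarrow> (stack_step M)\<^sup>*\<^sup>* (ks, map Push cs @ fs) (rev cs @ ks, fs)"
proof (induction cs arbitrary: ks)
  case (Cons c cs)
  then obtain k ks' where "ks = k # ks'" by (cases ks) auto
  then have "stack_step M (ks, map Push (c # cs) @ fs) (c # ks, map Push cs @ fs)"
    by (auto intro: stack_stepI)
  with Cons.IH[of "c # ks"] show ?case by (simp add: converse_rtranclp_into_rtranclp)
qed simp

text \<open>The letters turn one by one into pending \<open>Push\<close> functions, which reverses
  the word; their release over \<open>Bottom\<close> reverses it again.\<close>

lemma start_steps:
  "(stack_step M)\<^sup>*\<^sup>* (map Letter w @ [Empty], Start # fs) (map Symbol w @ [Bottom], fs)"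
proof -
  have "(stack_step M)\<^sup>*\<^sup>* (map Letter w @ [Empty], Start # fs)
      ([Bottom], map Push (rev (map Symbol w)) @ fs)"
  proof (induction w arbitrary: fs)
    case Nil
    have "stack_step M ([Empty], Start # fs) ([Bottom], fs)" by (rule stack_stepI) auto
    then show ?case by auto
  next
    case (Cons a w)
    have "stack_step M (map Letter (a # w) @ [Empty], Start # fs)
        (map Letter w @ [Empty], Start # Push (Symbol a) # fs)"
      by (auto intro: stack_stepI)
    with Cons.IH[of "Push (Symbol a) # fs"] show ?case
      by (simp add: converse_rtranclp_into_rtranclp)
  qed
  also have "(stack_step M)\<^sup>*\<^sup>* ([Bottom], map Push (rev (map Symbol w)) @ fs) (map Symbol w @ [Bottom], fs)"
    using push_steps[of "[Bottom]" M "rev (map Symbol w)" fs] by simp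
  finally show ?thesis .
qed

lemma clear_steps: "(stack_step M)\<^sup>*\<^sup>* (map Symbol cs @ [Bottom], Clear # fs) ([Empty], fs)"
proof (induction cs)
  case Nil
  have "stack_step M ([Bottom], Clear # fs) ([Empty], fs)" by (rule stack_stepI) auto
  then show ?case by auto
next
  case (Cons a cs)
  have "stack_step M (map Symbol (a # cs) @ [Bottom], Clear # fs) (map Symbol cs @ [Bottom], Clear # fs)"
    by (auto intro: stack_stepI)
  with Cons.IH show ?case by (simp add: converse_rtranclp_into_rtranclp)
qed

text \<open>The block before the first blank is reversed twice, as in \<open>start_steps\<close>,
  and \<open>Clear\<close> erases the rest. On a non-blank symbol outside the input alphabet
  \<open>Collect\<close> would be stuck, hence the hypothesis.\<close>

lemma collect_steps:
  assumes "set (takeWhile (\<lambda>b. b \<noteq> blank M) cs) \<subseteq> input_alphabet M"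
  shows "(stack_step M)\<^sup>*\<^sup>* (map Symbol cs @ [Bottom], Collect # fs)
    (map Letter (takeWhile (\<lambda>b. b \<noteq> blank M) cs) @ [Empty], fs)"
proof -
  let ?v = "takeWhile (\<lambda>b. b \<noteq> blank M) cs"
  have "(stack_step M)\<^sup>*\<^sup>* (map Symbol cs @ [Bottom], Collect # fs)
      ([Empty], map Push (rev (map Letter ?v)) @ fs)"
    using assms
  proof (induction cs arbitrary: fs)
    case Nil
    have "stack_step M ([Bottom], Collect # fs) ([Empty], fs)" by (rule stack_stepI) auto
    then show ?case by auto
  next
    case (Cons a cs)
    show ?case
    proof (cases "a = blank M")
      case True
      then have "stack_step M (map Symbol (a # cs) @ [Bottom], Collect # fs)
          (map Symbol cs @ [Bottom], Clear # fs)"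
        by (auto intro: stack_stepI)
      from converse_rtranclp_into_rtranclp[OF this clear_steps] True show ?thesis by simp
    next
      case False
      then have "stack_step M (map Symbol (a # cs) @ [Bottom], Collect # fs)
          (map Symbol cs @ [Bottom], Collect # Push (Letter a) # fs)"
        using Cons.prems by (auto intro: stack_stepI)
      with Cons.IH[of "Push (Letter a) # fs"] Cons.prems False show ?thesis
        by (simp add: converse_rtranclp_into_rtranclp)
    qed
  qed
  also have "(stack_step M)\<^sup>*\<^sup>* ([Empty], map Push (rev (map Letter ?v)) @ fs) (map Letter ?v @ [Empty], fs)"
    using push_steps[of "[Empty]" M "rev (map Letter ?v)" fs] by simp
  finally show ?thesis .
qed

section \<open>Machine steps as stack steps\<close>

text \<open>\<open>cs\<close> is the tape from the head onwards. The empty list and a single blank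
  give the same configuration but different stacks, so the simulation is indexed by lists instead of
  being a map on configurations.\<close>

definition config_of :: "('q, 'a) tm \<Rightarrow> 'q \<Rightarrow> 'a list \<Rightarrow> 'a list \<Rightarrow> ('q, 'a) config" where
  "config_of M q l cs = (q, l, head_or (blank M) cs, tl cs)"

definition stacks_of :: "'q \<Rightarrow> 'a list \<Rightarrow> 'a list \<Rightarrow> ('q, 'a) stacks" where
  "stacks_of q l cs = (map Symbol cs @ [Bottom], Head q # map Below l @ [Finish])"

definition on_tape :: "('q, 'a) tm \<Rightarrow> 'q \<Rightarrow> 'a list \<Rightarrow> 'a list \<Rightarrow> bool" where
  "on_tape M q l cs \<longleftrightarrow> q \<in> states M \<and> set l \<subseteq> tape_alphabet M \<and> set cs \<subseteq> tape_alphabet M"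

lemma halting_steps:
  assumes "q \<in> halting M" "set (takeWhile (\<lambda>b. b \<noteq> blank M) cs) \<subseteq> input_alphabet M"
  shows "(stack_step M)\<^sup>*\<^sup>* (stacks_of q l cs) (map Letter (takeWhile (\<lambda>b. b \<noteq> blank M) cs) @ [Empty], [])"
proof -
  have "stack_step M (stacks_of q l cs) (Drop # map Symbol cs @ [Bottom], map Below l @ [Finish])"
    using assms(1) by (cases cs) (auto simp: stacks_of_def intro!: stack_stepI)
  also have "(stack_step M)\<^sup>*\<^sup>* \<dots> (Drop # map Symbol cs @ [Bottom], [Finish])"
  proof (induction l)
    case (Cons a l)
    have "stack_step M (Drop # map Symbol cs @ [Bottom], map Below (a # l) @ [Finish])
        (Drop # map Symbol cs @ [Bottom], map Below l @ [Finish])"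
      by (auto intro: stack_stepI)
    with Cons.IH show ?case by (simp add: converse_rtranclp_into_rtranclp)
  qed simp
  also have "stack_step M (Drop # map Symbol cs @ [Bottom], [Finish]) (map Symbol cs @ [Bottom], [Collect])"
    by (auto intro: stack_stepI)
  also have "(stack_step M)\<^sup>*\<^sup>* (map Symbol cs @ [Bottom], [Collect])
      (map Letter (takeWhile (\<lambda>b. b \<noteq> blank M) cs) @ [Empty], [])"
    using collect_steps assms(2) by blast
  finally show ?thesis .
qed

text \<open>Beyond the end of \<open>cs\<close> the head reads a blank, at which
  \<open>takeWhile\<close> stops at once.\<close>

lemma takeWhile_config:
  "takeWhile (\<lambda>b. b \<noteq> blank M) (head_or (blank M) cs # tl cs) = takeWhile (\<lambda>b. b \<noteq> blank M) cs"
  by (cases cs) (auto simp: head_or_def)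

text \<open>A right move takes one stack step, a left move two: \<open>Head\<close> leaves
  \<open>Back\<close>, which takes the symbol from the next function. That there is at least one
  step is what carries divergence over.\<close>

lemma tm_step_stacks:
  assumes M: "turing_machine M" and "on_tape M q l cs" "q \<notin> halting M"
  obtains q' l' cs' where "on_tape M q' l' cs'" "tm_step M (config_of M q l cs) (config_of M q' l' cs')"
    "(stack_step M)\<^sup>+\<^sup>+ (stacks_of q l cs) (stacks_of q' l' cs')"
proof -
  let ?a = "head_or (blank M) cs"
  have blank: "blank M \<in> tape_alphabet M" using M by (simp add: turing_machine_def)
  have a: "?a \<in> tape_alphabet M"
    using assms(2) blank by (cases cs) (auto simp: head_or_def on_tape_def)
  have "set (tl cs) \<subseteq> set cs" "set (tl l) \<subseteq> set l"
    by (cases cs, auto) (cases l, auto)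
  then have tl: "set (tl cs) \<subseteq> tape_alphabet M" "set (tl l) \<subseteq> tape_alphabet M"
    using assms(2) by (auto simp: on_tape_def)
  obtain q' b d where delta: "delta M q ?a = (q', b, d)" by (metis surj_pair)
  have "q \<in> states M - halting M" using assms(2,3) by (simp add: on_tape_def)
  then have "delta M q ?a \<in> states M \<times> tape_alphabet M \<times> UNIV"
    using M a unfolding turing_machine_def by blast
  then have q': "q' \<in> states M" "b \<in> tape_alphabet M"
    using delta by auto
  show thesis
  proof (cases d)
    case L
    \<comment> \<open>In front of the symbol \<open>b\<close> just written stands the one fetched by
      \<open>Back\<close>. If the left tape is exhausted, \<open>Finish\<close> supplies a blank and
      renews itself.\<close>
    let ?cs = "head_or (blank M) l # b # tl cs"
    have "on_tape M q' (tl l) ?cs"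
      using assms(2) q' tl blank by (cases l) (auto simp: on_tape_def head_or_def)
    moreover have "tm_step M (config_of M q l cs) (config_of M q' (tl l) ?cs)"
      using tm_step.intros(1)[OF assms(3) delta[unfolded L], of l "tl cs"]
      by (simp add: config_of_def head_or_def)
    moreover have "stack_step M (stacks_of q l cs)
        (Back q' # Symbol b # map Symbol (tl cs) @ [Bottom], map Below l @ [Finish])"
      using delta L assms(3)
      by (cases cs) (auto simp: stacks_of_def move_def head_or_def intro!: stack_stepI)
    moreover have "stack_step M (Back q' # Symbol b # map Symbol (tl cs) @ [Bottom], map Below l @ [Finish])
        (stacks_of q' (tl l) ?cs)"
      by (cases l) (auto simp: stacks_of_def head_or_def intro!: stack_stepI)
    ultimately show thesis using that by (meson tranclp.r_into_trancl tranclp.trancl_into_trancl)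
  next
    case R
    have "on_tape M q' (b # l) (tl cs)"
      using assms(2) q' tl by (auto simp: on_tape_def)
    moreover have "tm_step M (config_of M q l cs) (config_of M q' (b # l) (tl cs))"
      using tm_step.intros(2)[OF assms(3) delta[unfolded R], of l "tl cs"]
      by (simp add: config_of_def)
    moreover have "stack_step M (stacks_of q l cs) (stacks_of q' (b # l) (tl cs))"
      using delta R assms(3)
      by (cases cs) (auto simp: stacks_of_def move_def head_or_def intro!: stack_stepI)
    ultimately show thesis using that by blast
  qed
qed

lemma right_unique_tm_step: "right_unique (tm_step M)"
  by (rule right_uniqueI) (auto elim!: tm_step.cases)

lemma tm_steps_stacks:
  assumes M: "turing_machine M" and "on_tape M q l cs" "(tm_step M)\<^sup>*\<^sup>* (config_of M q l cs) C"
  obtains q' l' cs' where "on_tape M q' l' cs'" "C = config_of M q' l' cs'"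
    "(stack_step M)\<^sup>*\<^sup>* (stacks_of q l cs) (stacks_of q' l' cs')"
proof -
  have "\<exists>q' l' cs'. on_tape M q' l' cs' \<and> C = config_of M q' l' cs' \<and>
      (stack_step M)\<^sup>*\<^sup>* (stacks_of q l cs) (stacks_of q' l' cs')"
    using assms(3)
  proof (induction rule: rtranclp_induct)
    case base
    then show ?case using assms(2) by blast
  next
    case (step C C')
    then obtain q' l' cs' where C: "on_tape M q' l' cs'" "C = config_of M q' l' cs'"
      "(stack_step M)\<^sup>*\<^sup>* (stacks_of q l cs) (stacks_of q' l' cs')" by blast
    have "q' \<notin> halting M" using step.hyps(2) C(2) by (auto simp: config_of_def elim: tm_step.cases)
    then obtain q'' l'' cs'' where D: "on_tape M q'' l'' cs''"
      "tm_step M (config_of M q' l' cs') (config_of M q'' l'' cs'')"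
      "(stack_step M)\<^sup>+\<^sup>+ (stacks_of q' l' cs') (stacks_of q'' l'' cs'')"
      using tm_step_stacks[OF M C(1)] by blast
    \<comment> \<open>The machine is deterministic, so the simulated successor is the given
      one.\<close>
    have "C' = config_of M q'' l'' cs''"
      using right_uniqueD[OF right_unique_tm_step] step.hyps(2) D(2) C(2) by metis
    moreover have "(stack_step M)\<^sup>*\<^sup>* (stacks_of q l cs) (stacks_of q'' l'' cs'')"
      using C(3) D(3) by (meson rtranclp_trans tranclp_into_rtranclp)
    ultimately show ?case using D(1) by blast
  qed
  with that show thesis by blast
qed

text \<open>Each simulated machine step uses up at least one of the \<open>n\<close> stack steps
  that lead to the normal form, so a halting state must be met.\<close>

lemma normal_stacks_halting:
  assumes M: "turing_machine M" and "\<nexists>c'. stack_step M c c'"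
  shows "on_tape M q l cs \<Longrightarrow> (stack_step M ^^ n) (stacks_of q l cs) c \<Longrightarrow>
    \<exists>q' l' a r. (tm_step M)\<^sup>*\<^sup>* (config_of M q l cs) (q', l', a, r) \<and> q' \<in> halting M"
proof (induction n arbitrary: q l cs rule: less_induct)
  case (less n)
  show ?case
  proof (cases "q \<in> halting M")
    case True
    then show ?thesis unfolding config_of_def by blast
  next
    case False
    then obtain q' l' cs' where D: "on_tape M q' l' cs'"
      "tm_step M (config_of M q l cs) (config_of M q' l' cs')"
      "(stack_step M)\<^sup>+\<^sup>+ (stacks_of q l cs) (stacks_of q' l' cs')"
      using tm_step_stacks[OF M less.prems(1)] by blast
    obtain m where "m < n" "(stack_step M ^^ m) (stacks_of q' l' cs') c"
      using deterministic_tranclp[OF right_unique_stack_step assms(2) D(3) less.prems(2)] by blast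
    with less.IH D(1,2) show ?thesis by (meson converse_rtranclp_into_rtranclp)
  qed
qed

definition input_stacks :: "('q, 'a) tm \<Rightarrow> 'a list \<Rightarrow> ('q, 'a) stacks" where
  "input_stacks M w = (map Letter w @ [Empty], [Start, Head (start M), Finish])"

definition output_stacks :: "'a list \<Rightarrow> ('q, 'a) stacks" where
  "output_stacks v = (map Letter v @ [Empty], [])"

lemma output_stacks_normal: "\<not> stack_step M (output_stacks v) c"
  by (auto simp: output_stacks_def elim: stack_step.cases)

lemma input_stacks_steps: "(stack_step M)\<^sup>*\<^sup>* (input_stacks M w) (stacks_of (start M) [] w)"
  using start_steps[of M w "[Head (start M), Finish]"] by (simp add: input_stacks_def stacks_of_def)

lemma initial_on_tape:
  assumes "turing_machine M" "w \<in> lists (input_alphabet M)"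
  shows "on_tape M (start M) [] w"
  using assms by (auto simp: on_tape_def turing_machine_def)

lemma halts_stack_steps:
  assumes "turing_machine M" "w \<in> lists (input_alphabet M)" "tm_halts_with M w v"
    and "v \<in> lists (input_alphabet M)"
  shows "(stack_step M)\<^sup>*\<^sup>* (input_stacks M w) (output_stacks v)"
proof -
  obtain q l a r where halt: "(tm_step M)\<^sup>*\<^sup>* (config_of M (start M) [] w) (q, l, a, r)" "q \<in> halting M"
    "v = takeWhile (\<lambda>b. b \<noteq> blank M) (a # r)"
    using assms(3) unfolding tm_halts_with_def initial_config_def config_of_def by blast
  obtain q' l' cs where cs: "(q, l, a, r) = config_of M q' l' cs"
    "(stack_step M)\<^sup>*\<^sup>* (stacks_of (start M) [] w) (stacks_of q' l' cs)"
    using tm_steps_stacks[OF assms(1) initial_on_tape[OF assms(1,2)] halt(1)] by metis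
  have "v = takeWhile (\<lambda>b. b \<noteq> blank M) cs"
    using halt(3) cs(1) takeWhile_config[of M cs] by (auto simp only: config_of_def prod.inject)
  then have "(stack_step M)\<^sup>*\<^sup>* (stacks_of q' l' cs) (output_stacks v)"
    using halting_steps[of q' M cs l'] halt(2) cs(1) assms(4)
    by (auto simp: config_of_def output_stacks_def)
  with cs(2) input_stacks_steps show ?thesis by (meson rtranclp_trans)
qed

text \<open>Stuck stacks are covered as well as results: when the machine runs forever, the
  semantics forbids every normal form, whether a value or not.\<close>

lemma normal_form_halts:
  assumes "turing_machine M" "w \<in> lists (input_alphabet M)"
    and "(stack_step M)\<^sup>*\<^sup>* (input_stacks M w) c" "\<nexists>c'. stack_step M c c'"
  shows "\<exists>v. tm_halts_with M w v"
proof -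
  have "(stack_step M)\<^sup>*\<^sup>* (stacks_of (start M) [] w) c"
    using deterministic_rtranclp[OF right_unique_stack_step assms(4) input_stacks_steps assms(3)] .
  then obtain n where "(stack_step M ^^ n) (stacks_of (start M) [] w) c"
    by (auto simp: rtranclp_power)
  then show ?thesis
    using normal_stacks_halting[OF assms(1,4) initial_on_tape[OF assms(1,2)]]
    unfolding tm_halts_with_def initial_config_def config_of_def by blast
qed

section \<open>The program of a Turing machine\<close>

text \<open>Cells are named by numbers while states and symbols have arbitrary types, possibly
  uncountable; injections exist at least on the finite sets of cells.\<close>

locale coded_tm =
  fixes M :: "('q, 'a) tm"
    and code_constr :: "('q, 'a) tm_constr \<Rightarrow> nat" and code_fun :: "('q, 'a) tm_fun \<Rightarrow> nat"
  assumes M: "turing_machine M"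
    and inj_constr: "inj_on code_constr (tm_constrs M)"
    and inj_fun: "inj_on code_fun (tm_funs M)"
begin

definition decode_constr :: "nat \<Rightarrow> ('q, 'a) tm_constr" where
  "decode_constr = inv_into (tm_constrs M) code_constr"

definition decode_fun :: "nat \<Rightarrow> ('q, 'a) tm_fun" where
  "decode_fun = inv_into (tm_funs M) code_fun"

lemma decode_constr [simp]: "k \<in> tm_constrs M \<Longrightarrow> decode_constr (code_constr k) = k"
  by (simp add: decode_constr_def inv_into_f_f[OF inj_constr])

lemma decode_fun [simp]: "\<phi> \<in> tm_funs M \<Longrightarrow> decode_fun (code_fun \<phi>) = \<phi>"
  by (simp add: decode_fun_def inv_into_f_f[OF inj_fun])

text \<open>Both stacks begin at the boundary between them, whereas a word begins at the output end;
  hence only the functions are reversed.\<close>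

definition stack_word :: "('q, 'a) stacks \<Rightarrow> (nat, nat, nat) cell2 list" where
  "stack_word c = map (Fun \<circ> code_fun) (rev (snd c)) @ map (Constr \<circ> code_constr) (fst c)"

text \<open>A rule is named by the pair of codes of its two cells, from which its table entry is
  recovered.\<close>

definition lhs_constr :: "nat \<Rightarrow> nat" where "lhs_constr r = fst (prod_decode r)"

definition lhs_fun :: "nat \<Rightarrow> nat" where "lhs_fun r = snd (prod_decode r)"

definition rhs :: "nat \<Rightarrow> (nat, nat, nat) cell2 list" where
  "rhs r = stack_word (the (table M (decode_constr (lhs_constr r)) (decode_fun (lhs_fun r))))"

definition P :: "(nat, nat, nat, nat) program" where
  "P = \<lparr> sorts = {0, 1},
     constrs = code_constr ` tm_constrs M,
     constr_src = \<lambda>n. tm_constr_src (decode_constr n),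
     constr_tgt = \<lambda>n. tm_constr_tgt (decode_constr n),
     funs = code_fun ` tm_funs M,
     fun_src = \<lambda>n. [tm_fun_src (decode_fun n)],
     fun_tgt = \<lambda>n. [tm_fun_tgt (decode_fun n)],
     rules = {prod_encode (code_constr k, code_fun \<phi>) | k \<phi>. k \<in> tm_constrs M \<and> \<phi> \<in> tm_funs M \<and>
       tm_constr_tgt k = tm_fun_src \<phi> \<and> table M k \<phi> \<noteq> None},
     rule_src = \<lambda>r. Cell (Constr (lhs_constr r)) \<star>\<^sub>1 Cell (Fun (lhs_fun r)),
     rule_tgt = \<lambda>r. comp_word (tm_constr_src (decode_constr (lhs_constr r))) (rhs r) \<rparr>"

lemma P_simps [simp]:
  "sorts P = {0, 1}"
  "constrs P = code_constr ` tm_constrs M"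
  "constr_src P n = tm_constr_src (decode_constr n)"
  "constr_tgt P n = tm_constr_tgt (decode_constr n)"
  "funs P = code_fun ` tm_funs M"
  "fun_src P n = [tm_fun_src (decode_fun n)]"
  "fun_tgt P n = [tm_fun_tgt (decode_fun n)]"
  "rule_src P r = Cell (Constr (lhs_constr r)) \<star>\<^sub>1 Cell (Fun (lhs_fun r))"
  "rule_tgt P r = comp_word (tm_constr_src (decode_constr (lhs_constr r))) (rhs r)"
  by (simp_all add: P_def)

lemma rulesE:
  assumes "r \<in> rules P"
  obtains k \<phi> ls gs where "k \<in> tm_constrs M" "\<phi> \<in> tm_funs M" "tm_constr_tgt k = tm_fun_src \<phi>"
    "table M k \<phi> = Some (ls, gs)" "lhs_constr r = code_constr k" "lhs_fun r = code_fun \<phi>"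
    "rhs r = stack_word (ls, gs)"
  using assms by (fastforce simp: P_def lhs_constr_def lhs_fun_def rhs_def)

lemma ruleI:
  assumes "k \<in> tm_constrs M" "\<phi> \<in> tm_funs M" "tm_constr_tgt k = tm_fun_src \<phi>" "table M k \<phi> = Some (ls, gs)"
  obtains r where "r \<in> rules P" "lhs_constr r = code_constr k" "lhs_fun r = code_fun \<phi>"
    "rhs r = stack_word (ls, gs)"
proof
  let ?r = "prod_encode (code_constr k, code_fun \<phi>)"
  show "?r \<in> rules P" using assms by (auto simp: P_def)
  show "lhs_constr ?r = code_constr k" "lhs_fun ?r = code_fun \<phi>" "rhs ?r = stack_word (ls, gs)"
    using assms by (simp_all add: lhs_constr_def lhs_fun_def rhs_def)
qed

text \<open>Typing of words in terms of the cells themselves instead of their codes; these rules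
  take the place of \<open>chain.simps\<close> in simplification.\<close>

lemma chain_Constr [simp]:
  "k \<in> tm_constrs M \<Longrightarrow> chain (polygraph_of P) u (Constr (code_constr k) # w) v \<longleftrightarrow>
    v = [tm_constr_tgt k] \<and> chain (polygraph_of P) u w (tm_constr_src k)"
  by (auto simp: polygraph_of_def program_cells2_def)

lemma chain_Fun [simp]:
  "\<phi> \<in> tm_funs M \<Longrightarrow> chain (polygraph_of P) u (Fun (code_fun \<phi>) # w) v \<longleftrightarrow>
    v = [tm_fun_tgt \<phi>] \<and> chain (polygraph_of P) u w [tm_fun_src \<phi>]"
  by (auto simp: polygraph_of_def program_cells2_def)

lemma chain_Nil [simp]: "chain (polygraph_of P) u [] v \<longleftrightarrow> u = v \<and> set u \<subseteq> {0, 1}"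
  by (simp add: polygraph_of_def)

declare chain.simps [simp del]

lemma delta_type:
  assumes "q \<in> states M" "q \<notin> halting M" "a \<in> tape_alphabet M" "delta M q a = (q', b, d)"
  shows "q' \<in> states M \<and> b \<in> tape_alphabet M"
proof -
  have "delta M q a \<in> states M \<times> tape_alphabet M \<times> UNIV"
    using M assms(1-3) unfolding turing_machine_def by blast
  then show ?thesis using assms(4) by simp
qed

lemma alphabet: "input_alphabet M \<subseteq> tape_alphabet M" "blank M \<in> tape_alphabet M" "start M \<in> states M"
  using M by (auto simp: turing_machine_def)

lemma input_on_tape: "a \<in> input_alphabet M \<Longrightarrow> a \<in> tape_alphabet M"
  using alphabet(1) by blast

lemma constrs_iff [simp]:
  "Empty \<in> tm_constrs M" "Bottom \<in> tm_constrs M" "Drop \<in> tm_constrs M"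
  "Letter a \<in> tm_constrs M \<longleftrightarrow> a \<in> input_alphabet M"
  "Symbol a \<in> tm_constrs M \<longleftrightarrow> a \<in> tape_alphabet M"
  "Back q \<in> tm_constrs M \<longleftrightarrow> q \<in> states M"
  by (auto simp: tm_constrs_def)

lemma funs_iff [simp]:
  "Start \<in> tm_funs M" "Finish \<in> tm_funs M" "tm_fun.Collect \<in> tm_funs M" "Clear \<in> tm_funs M"
  "Head q \<in> tm_funs M \<longleftrightarrow> q \<in> states M"
  "Below a \<in> tm_funs M \<longleftrightarrow> a \<in> tape_alphabet M"
  "Push k \<in> tm_funs M \<longleftrightarrow> (\<exists>a\<in>input_alphabet M. k = Letter a) \<or> (\<exists>a\<in>tape_alphabet M. k = Symbol a)"
  by (auto simp: tm_funs_def)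

text \<open>The conditions leave \<open>[]\<close> and \<open>[Bottom]\<close> for
  \<open>base\<close>: with the former the word still awaits the rest of the tape, with the latter
  it is closed.\<close>

lemma move_type:
  assumes "q \<in> states M" "q \<notin> halting M" "a \<in> tape_alphabet M" "move M q a base = (ls, gs)"
    "set base \<subseteq> {Bottom}" "length base \<le> 1"
  shows "set ls \<subseteq> tm_constrs M \<and> set gs \<subseteq> tm_funs M \<and>
    chain (polygraph_of P) (if base = [] then [1] else []) (stack_word (ls, gs)) [1]"
proof -
  obtain q' b d where d: "delta M q a = (q', b, d)" by (metis surj_pair)
  note qb = delta_type[OF assms(1-3) d]
  have "base = [] \<or> base = [Bottom]" using assms(5,6) by (cases base) auto
  then show ?thesis
    using d qb assms(4) by (cases d) (auto simp: move_def stack_word_def)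
qed

lemma table_type:
  assumes "table M k \<phi> = Some (ls, gs)" "k \<in> tm_constrs M" "\<phi> \<in> tm_funs M" "tm_constr_tgt k = tm_fun_src \<phi>"
  shows "set ls \<subseteq> tm_constrs M \<and> set gs \<subseteq> tm_funs M \<and>
    chain (polygraph_of P) (tm_constr_src k) (stack_word (ls, gs)) [tm_fun_tgt \<phi>]"
proof (cases \<phi>)
  case Start
  then show ?thesis using assms
    by (cases k) (auto simp: stack_word_def input_on_tape)
next
  case (Head q)
  show ?thesis
  proof (cases "q \<in> halting M")
    case True
    then show ?thesis using assms alphabet Head
      by (cases k) (auto simp: stack_word_def)
  next
    case False
    show ?thesis
      using assms alphabet Head False move_type[OF _ False, of _ "[]" ls gs]
        move_type[OF _ False, of "blank M" "[Bottom]" ls gs]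
      by (cases k) auto
  qed
next
  case (Below a)
  then show ?thesis using assms alphabet
    by (cases k) (auto simp: stack_word_def)
next
  case Finish
  then show ?thesis using assms alphabet
    by (cases k) (auto simp: stack_word_def)
next
  case (Push c)
  then show ?thesis using assms alphabet
    by (cases k; cases c) (auto simp: stack_word_def)
next
  case Collect
  then show ?thesis using assms alphabet
    by (cases k) (auto simp: stack_word_def split: if_splits)
next
  case Clear
  then show ?thesis using assms alphabet
    by (cases k) (auto simp: stack_word_def)
qed

lemma set_stack_word: "set (stack_word c) \<subseteq> range Constr \<union> range Fun"
  by (auto simp: stack_word_def)

sublocale linear_program P lhs_constr lhs_fun rhs
proof
  show "set (constr_src P \<gamma>) \<subseteq> sorts P \<and> constr_tgt P \<gamma> \<in> sorts P \<and> length (constr_src P \<gamma>) \<le> 1" for \<gamma>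
    by (cases "decode_constr \<gamma>") auto
  have "tm_constr_tgt k \<in> {0, 1}" for k :: "('q, 'a) tm_constr" by (cases k) auto
  then have "tm_fun_src \<phi> \<in> {0, 1} \<and> tm_fun_tgt \<phi> \<in> {0, 1}" for \<phi> :: "('q, 'a) tm_fun"
    by (cases \<phi>) auto
  then show "set (fun_src P \<phi>) \<subseteq> sorts P \<and> set (fun_tgt P \<phi>) \<subseteq> sorts P \<and>
      length (fun_src P \<phi>) = 1 \<and> length (fun_tgt P \<phi>) = 1" for \<phi>
    by simp
  fix r
  assume "r \<in> rules P"
  then obtain k \<phi> ls gs where r: "k \<in> tm_constrs M" "\<phi> \<in> tm_funs M" "tm_constr_tgt k = tm_fun_src \<phi>"
    "table M k \<phi> = Some (ls, gs)" "lhs_constr r = code_constr k" "lhs_fun r = code_fun \<phi>"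
    "rhs r = stack_word (ls, gs)"
    by (rule rulesE)
  then show "rule_src P r = Cell (Constr (lhs_constr r)) \<star>\<^sub>1 Cell (Fun (lhs_fun r)) \<and>
      rule_tgt P r = comp_word (constr_src P (lhs_constr r)) (rhs r) \<and>
      lhs_constr r \<in> constrs P \<and> lhs_fun r \<in> funs P \<and>
      fun_src P (lhs_fun r) = [constr_tgt P (lhs_constr r)] \<and>
      chain (polygraph_of P) (constr_src P (lhs_constr r)) (rhs r) (fun_tgt P (lhs_fun r)) \<and>
      set (rhs r) \<subseteq> range Constr \<union> range Fun"
    using table_type[OF r(4,1,2,3)] set_stack_word by simp
qed

notation eqv (infix "\<approx>" 50)

lemma finite_P: "finite_program P"
proof -
  have fin: "finite (states M)" "finite (tape_alphabet M)" "finite (input_alphabet M)"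
    using M by (auto simp: turing_machine_def intro: finite_subset)
  then have K: "finite (tm_constrs M)" and F: "finite (tm_funs M)"
    by (auto simp: tm_constrs_def tm_funs_def)
  have "rules P \<subseteq> (\<lambda>(k, \<phi>). prod_encode (code_constr k, code_fun \<phi>)) ` (tm_constrs M \<times> tm_funs M)"
    by (auto simp: P_def)
  then have "finite (rules P)" using K F by (meson finite_SigmaI finite_imageI finite_subset)
  with K F show ?thesis by (simp add: finite_program_def)
qed

lemma polygraphic_P: "polygraphic_program P"
  unfolding polygraphic_program_def
proof (intro conjI ballI exI)
  show "monoidal_3_polygraph (polygraph_of P)" by (rule monoidal)
  show "polytime_rewriting P" by (rule finite_program_polytime[OF finite_P monoidal])
  fix r
  assume r: "r \<in> rules P"
  note rule = rules_linear[OF r]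
  show "lhs_fun r \<in> funs P" using rule by blast
  show "only_constrs (Cell (Constr (lhs_constr r)) :: (nat, (nat, nat, nat) cell2) expr)"
    by (simp add: only_constrs_def)
  show "same_path (polygraph_of P) (rule_src P r)
      (Cell (Constr (lhs_constr r)) \<star>\<^sub>1 Cell (Fun (lhs_fun r)))"
    using rule_src_type[OF r] eqv_refl has_type_iff rule by metis
  \<comment> \<open>Right-hand sides consist of constructors and functions, so the bound on
    structure 2-cells can be 0.\<close>
  have "set (cells_of (rule_tgt P r)) \<subseteq> range Constr \<union> range Fun"
    using rule by simp
  then have "filter is_structure (cells_of (rule_tgt P r)) = []"
    by (auto simp: filter_empty_conv)
  then show "length (filter is_structure (cells_of (rule_tgt P r))) \<le> 0" by simp
qed

lemma word_sort_P: "word_sort P (input_alphabet M) 0 (code_constr Empty) (\<lambda>a. code_constr (Letter a))"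
proof -
  have "tm_constr_tgt k = 0 \<longleftrightarrow> k = Empty \<or> (\<exists>a. k = Letter a)" for k :: "('q, 'a) tm_constr"
    by (cases k) auto
  then have "{\<gamma> \<in> constrs P. constr_tgt P \<gamma> = 0} =
      insert (code_constr Empty) ((\<lambda>a. code_constr (Letter a)) ` input_alphabet M)"
    by auto
  moreover have "inj_on (\<lambda>a. code_constr (Letter a)) (input_alphabet M)"
    by (rule inj_onI) (use inj_onD[OF inj_constr] in fastforce)
  ultimately show ?thesis by (simp add: word_sort_def)
qed

section \<open>Stack steps as rewriting steps\<close>

definition typed_stacks :: "('q, 'a) stacks \<Rightarrow> bool" where
  "typed_stacks c \<longleftrightarrow> set (fst c) \<subseteq> tm_constrs M \<and> set (snd c) \<subseteq> tm_funs M \<and>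
     chain (polygraph_of P) [] (stack_word c) [0]"

definition stack_path :: "('q, 'a) stacks \<Rightarrow> (nat, (nat, nat, nat) cell2) path2" where
  "stack_path c = path2_of (polygraph_of P) (comp_word [] (stack_word c))"

text \<open>For functions \<open>xs\<close> and constructors \<open>ys\<close> this says that a
  redex, a function next to a constructor, lies astride the boundary. Hence the uniqueness of the
  redex.\<close>

lemma append_eq_append_boundary:
  assumes "xs @ ys = p @ a # b # z" "a \<notin> set ys" "b \<notin> set xs"
  shows "xs = p @ [a] \<and> ys = b # z"
  using assms by (auto simp: append_eq_append_conv2 append_eq_Cons_conv Cons_eq_append_conv)

lemma rewrite_stack_path:
  assumes "typed_stacks c" "rewrite_step G (stack_path c) Y"
  obtains c' where "stack_step M c c'" "typed_stacks c'" "Y = stack_path c'"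
proof -
  obtain ks fs where c: "c = (ks, fs)" by (cases c)
  have typed: "set ks \<subseteq> tm_constrs M" "set fs \<subseteq> tm_funs M" "chain G [] (stack_word c) [0]"
    using assms(1) by (auto simp: typed_stacks_def c)
  obtain r p z where r: "r \<in> rules P" "stack_word c = p @ Fun (lhs_fun r) # Constr (lhs_constr r) # z"
    "Y = path2_of G (comp_word [] (p @ rhs r @ z))"
    using rewrite_step_cases[OF typed(3) set_stack_word assms(2)[unfolded stack_path_def]] .
  obtain k \<phi> ls gs where rule: "k \<in> tm_constrs M" "\<phi> \<in> tm_funs M" "tm_constr_tgt k = tm_fun_src \<phi>"
    "table M k \<phi> = Some (ls, gs)" "lhs_constr r = code_constr k" "lhs_fun r = code_fun \<phi>"
    "rhs r = stack_word (ls, gs)"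
    using r(1) by (rule rulesE)
  have "map (Fun \<circ> code_fun) (rev fs) = p @ [Fun (code_fun \<phi>)] \<and>
      map (Constr \<circ> code_constr) ks = Constr (code_constr k) # z"
    by (rule append_eq_append_boundary) (use r(2) rule c in \<open>auto simp: stack_word_def\<close>)
  then have "rev (map (Fun \<circ> code_fun) fs) = p @ [Fun (code_fun \<phi>)]"
    and ks: "map (Constr \<circ> code_constr) ks = Constr (code_constr k) # z"
    by (simp_all add: rev_map)
  then have "map (Fun \<circ> code_fun) fs = Fun (code_fun \<phi>) # rev p" by (simp add: rev_eq_append_conv)
  then obtain \<phi>' fs' where fs: "fs = \<phi>' # fs'" "code_fun \<phi>' = code_fun \<phi>"
      "map (Fun \<circ> code_fun) fs' = rev p"
    by auto
  then have p: "p = map (Fun \<circ> code_fun) (rev fs')" by (simp add: rev_map[symmetric])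
  from ks obtain k' ks' where ks: "ks = k' # ks'" "code_constr k' = code_constr k"
      "z = map (Constr \<circ> code_constr) ks'"
    by auto
  \<comment> \<open>Codes are injective only on the cells of the program, which is why the stacks
    must be typed.\<close>
  have eq: "\<phi>' = \<phi>" "k' = k"
    using typed fs ks rule inj_onD[OF inj_fun] inj_onD[OF inj_constr] by auto
  let ?c = "(ls @ ks', gs @ fs')"
  have word: "p @ rhs r @ z = stack_word ?c"
    by (simp add: rule(7) stack_word_def p ks(3))
  have "chain G [] (p @ rhs r @ z) [0]"
    by (rule rewrite_stepI(2)[OF r(1)]) (use typed(3) r(2) set_stack_word[of c] in auto)
  then have "typed_stacks ?c"
    using word typed fs ks table_type[OF rule(4,1,2,3)] by (auto simp: typed_stacks_def)
  moreover have "stack_step M c ?c"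
    using stack_step.intros[OF rule(4)] c fs ks eq by simp
  ultimately show thesis using that r(3) word by (simp add: stack_path_def)
qed

lemma stack_step_rewrite:
  assumes "typed_stacks c" "stack_step M c c'"
  shows "rewrite_step G (stack_path c) (stack_path c')" "typed_stacks c'"
proof -
  obtain k \<phi> ls gs ks fs where c: "c = (k # ks, \<phi> # fs)" "c' = (ls @ ks, gs @ fs)"
    and t: "table M k \<phi> = Some (ls, gs)"
    using assms(2) by (auto elim: stack_step.cases)
  have typed: "k \<in> tm_constrs M" "\<phi> \<in> tm_funs M" "set ks \<subseteq> tm_constrs M" "set fs \<subseteq> tm_funs M"
    "chain G [] (stack_word c) [0]"
    using assms(1) by (auto simp: typed_stacks_def c)
  let ?p = "map (Fun \<circ> code_fun) (rev fs)" and ?z = "map (Constr \<circ> code_constr) ks"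
  have word: "stack_word c = ?p @ Fun (code_fun \<phi>) # Constr (code_constr k) # ?z"
    by (simp add: c stack_word_def)
  \<comment> \<open>The program has a rule for a table entry only if the sorts match; the typing of
    the whole word ensures it.\<close>
  have "tm_constr_tgt k = tm_fun_src \<phi>"
    using typed(5) unfolding word chain_append by (auto simp: typed)
  then obtain r where r: "r \<in> rules P" "lhs_constr r = code_constr k" "lhs_fun r = code_fun \<phi>"
    "rhs r = stack_word (ls, gs)"
    using ruleI[OF typed(1,2) _ t] by blast
  have word': "stack_word c' = ?p @ rhs r @ ?z"
    by (simp add: c r stack_word_def)
  have lhs: "chain G [] (?p @ Fun (lhs_fun r) # Constr (lhs_constr r) # ?z) [0]"
    "set (?p @ Fun (lhs_fun r) # Constr (lhs_constr r) # ?z) \<subseteq> range Constr \<union> range Fun"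
    using typed(5) word r by auto
  show "rewrite_step G (stack_path c) (stack_path c')"
    unfolding stack_path_def word word' using rewrite_stepI(1)[OF r(1) lhs] r by simp
  have "chain G [] (stack_word c') [0]" using rewrite_stepI(2)[OF r(1) lhs] word' by simp
  then show "typed_stacks c'"
    using typed table_type[OF t typed(1,2) \<open>tm_constr_tgt k = tm_fun_src \<phi>\<close>]
    by (auto simp: typed_stacks_def c(2))
qed

text \<open>By the two simulations, reachable 2-paths are the paths of reachable stacks, and one is
  irreducible exactly when the other is.\<close>

lemma normal_form_of_stack_path:
  assumes "typed_stacks c"
  shows "normal_form_of G (stack_path c) Y \<longleftrightarrow>
    (\<exists>c'. (stack_step M)\<^sup>*\<^sup>* c c' \<and> (\<nexists>c''. stack_step M c' c'') \<and> Y = stack_path c')"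
proof
  assume Y: "normal_form_of G (stack_path c) Y"
  then have "(rewrite_step G)\<^sup>*\<^sup>* (stack_path c) Y" by (simp add: normal_form_of_def)
  then have "\<exists>c'. (stack_step M)\<^sup>*\<^sup>* c c' \<and> typed_stacks c' \<and> Y = stack_path c'"
  proof (induction rule: rtranclp_induct)
    case base
    then show ?case using assms by blast
  next
    case (step Y Z)
    then show ?case using rewrite_stack_path by (metis rtranclp.rtrancl_into_rtrancl)
  qed
  then show "\<exists>c'. (stack_step M)\<^sup>*\<^sup>* c c' \<and> (\<nexists>c''. stack_step M c' c'') \<and> Y = stack_path c'"
    using Y stack_step_rewrite unfolding normal_form_of_def by blast
next
  assume "\<exists>c'. (stack_step M)\<^sup>*\<^sup>* c c' \<and> (\<nexists>c''. stack_step M c' c'') \<and> Y = stack_path c'"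
  then obtain c' where c': "(stack_step M)\<^sup>*\<^sup>* c c'" "\<nexists>c''. stack_step M c' c''" "Y = stack_path c'"
    by blast
  from c'(1) have "(rewrite_step G)\<^sup>*\<^sup>* (stack_path c) (stack_path c') \<and> typed_stacks c'"
  proof (induction rule: rtranclp_induct)
    case base
    then show ?case using assms by blast
  next
    case (step x y)
    then show ?case using stack_step_rewrite by (meson rtranclp.rtrancl_into_rtrancl)
  qed
  then show "normal_form_of G (stack_path c) Y"
    unfolding normal_form_of_def using c'(2,3) rewrite_stack_path by metis
qed

section \<open>Words as values\<close>

abbreviation "empty_word \<equiv> code_constr Empty"

abbreviation "letter \<equiv> \<lambda>a. code_constr (Letter a)"

abbreviation "word \<equiv> word_val P empty_word letter"

lemma typed_output_stacks:
  assumes "w \<in> lists (input_alphabet M)"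
  shows "typed_stacks (output_stacks w)"
proof -
  have "chain G [] (map (Constr \<circ> code_constr) (map Letter w @ [Empty])) [0]"
    using assms by (induction w) auto
  then show ?thesis using assms by (auto simp: typed_stacks_def output_stacks_def stack_word_def)
qed

text \<open>The two expressions differ only by the \<open>Path []\<close> with which
  \<open>comp_word\<close> begins.\<close>

lemma word_expr_eqv:
  assumes "w \<in> lists (input_alphabet M)"
  shows "word_expr empty_word letter w \<approx> comp_word [] (stack_word (output_stacks w))"
  using assms
proof (induction w)
  case Nil
  show ?case using same_path.sym[OF eqv_unit1_left[of "Cell (Constr empty_word)" "[]"]]
    by (simp add: stack_word_def output_stacks_def)
next
  case (Cons a w)
  then have IH: "word_expr empty_word letter w \<approx> comp_word [] (stack_word (output_stacks w))"
    and a: "a \<in> input_alphabet M" by auto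
  have "cod1 (word_expr empty_word letter w) = [0]"
    using Cons by (cases w) auto
  then show ?case using eqv_cong1[OF IH eqv_refl[of "Cell (Constr (letter a))"]] a
    by (simp add: stack_word_def output_stacks_def)
qed

lemma word_eq_stack_path: "w \<in> lists (input_alphabet M) \<Longrightarrow> word w = stack_path (output_stacks w)"
  unfolding word_val_def stack_path_def using path2_of_eqI word_expr_eqv by blast

lemma word_expr_type:
  assumes "w \<in> lists (input_alphabet M)"
  shows "has_type G (word_expr empty_word letter w) [] [0]"
  using same_path_typed[OF word_expr_eqv[OF assms]] typed_output_stacks[OF assms]
    comp_word_typed[of "[]" "stack_word (output_stacks w)" "[0]"]
  by (simp add: has_type_iff typed_stacks_def)

text \<open>The function computed acts on 2-paths and has to recover the word from its
  representation; traces make this possible.\<close>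

lemma inj_on_word: "inj_on (\<lambda>w. [word w]) (lists (input_alphabet M))"
proof (rule inj_onI)
  fix w w'
  assume w: "w \<in> lists (input_alphabet M)" "w' \<in> lists (input_alphabet M)" "[word w] = [word w']"
  let ?c = "stack_word (output_stacks w)" and ?c' = "stack_word (output_stacks w')"
  have chains: "chain G [] ?c [0]" "chain G [] ?c' [0]"
    using typed_output_stacks w by (auto simp: typed_stacks_def)
  have "comp_word [] ?c \<approx> comp_word [] ?c'"
    using w word_eq_stack_path path2_of_eq_iff comp_word_typed[OF chains(1)] by (simp add: stack_path_def)
  then have "?c = ?c'"
    using comp_word_eqv_iff[OF chains(1) _ chains(2)] linear_chain chains set_stack_word by blast
  then have eq: "map (\<lambda>a. Constr (letter a) :: (nat, nat, nat) cell2) w = map (\<lambda>a. Constr (letter a)) w'"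
    by (simp add: stack_word_def output_stacks_def comp_def)
  have "inj_on letter (input_alphabet M)" using word_sort_P by (simp add: word_sort_def)
  moreover have "set w \<subseteq> input_alphabet M" "set w' \<subseteq> input_alphabet M" using w(1,2) by auto
  ultimately have "inj_on (\<lambda>a. Constr (letter a) :: (nat, nat, nat) cell2) (set w \<union> set w')"
    unfolding inj_on_def cell2.inject by blast
  then show "w = w'" using eq by (simp add: inj_on_map_eq_map)
qed

text \<open>The constructors of sort 0 are \<open>Empty\<close>, at which a word ends, and the
  letters, whose input again has sort 0; so no tape constructor can occur.\<close>

lemma value_is_word:
  assumes "X \<in> vals P 0"
  obtains w where "w \<in> lists (input_alphabet M)" "X = word w"
proof -
  obtain a where a: "X = path2_of G a" "has_type G a [] [0]" "only_constrs a"
    using assms by (auto simp: vals_def)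
  have "\<forall>c\<in>set (cells_of a). linear c"
    using linear_cells[of a] a(2,3) by (auto simp: only_constrs_def has_type_iff)
  then obtain w where w: "a \<approx> comp_word [] w" "chain G [] w [0]" "set w = set (cells_of a)"
    using closed_linear_word[OF a(2)] by metis
  have "set w \<subseteq> range Constr" using w(3) a(3) by (simp add: only_constrs_def)
  with w(2) have "\<exists>v\<in>lists (input_alphabet M). w = stack_word (output_stacks v)"
  proof (induction w)
    case (Cons c w)
    then obtain k where k: "k \<in> tm_constrs M" "c = Constr (code_constr k)"
      by (auto simp: chain.simps(2))
    have chain: "tm_constr_tgt k = 0" "chain G [] w (tm_constr_src k)"
      using Cons.prems(1) unfolding k(2) by (auto simp: k(1))
    show ?case
    proof (cases k)
      case Empty
      \<comment> \<open>Every constructor has an output, and \<open>Empty\<close> has no input to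
        receive it.\<close>
      have "w = []"
      proof (rule ccontr)
        assume "w \<noteq> []"
        then obtain x w' where "w = Constr x # w'" using Cons.prems(2) by (cases w) auto
        then have "[] = tgt1 G (Constr x)" using chain(2) Empty by (simp add: chain.simps(2))
        then show False by simp
      qed
      then show ?thesis using Empty k by (intro bexI[of _ "[]"]) (auto simp: stack_word_def output_stacks_def)
    next
      case (Letter b)
      then obtain v where "v \<in> lists (input_alphabet M)" "w = stack_word (output_stacks v)"
        using Cons.IH Cons.prems(2) chain by auto
      then show ?thesis using Letter k by (intro bexI[of _ "b # v"]) (auto simp: stack_word_def output_stacks_def)
    qed (use chain in auto)
  qed simp
  then obtain v where v: "v \<in> lists (input_alphabet M)" "w = stack_word (output_stacks v)" by blast
  then have "X = word v" using a(1) w(1) path2_of_eqI word_eq_stack_path by (simp add: stack_path_def)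
  with v(1) that show thesis by blast
qed

lemma word_value:
  assumes "w \<in> lists (input_alphabet M)"
  shows "word w \<in> vals P 0"
proof -
  have "only_constrs (word_expr empty_word letter w :: (nat, (nat, nat, nat) cell2) expr)"
    by (induction w) (auto simp: only_constrs_def)
  then show ?thesis using word_expr_type[OF assms] by (auto simp: vals_def word_val_def)
qed

lemma parallel_word:
  assumes "w \<in> lists (input_alphabet M)"
  shows "parallel P [word w] = word w"
proof -
  have wt: "well_typed (word_expr empty_word letter w)" using word_expr_type[OF assms] by (simp add: has_type_iff)
  have "parallel P [word w] = path2_of G (word_expr empty_word letter w \<star>\<^sub>0 Path [])"
    using wt by (simp add: parallel_def word_val_def comp0_path2_of)
  then show ?thesis using path2_of_eqI[OF eqv_unit0_right[OF wt]] by (simp add: word_val_def)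
qed

text \<open>The initial head and the end of the still empty left tape belong to the 2-path and wait
  until \<open>Start\<close> has delivered the tape.\<close>

definition main_expr :: "(nat, (nat, nat, nat) cell2) expr" where
  "main_expr = comp_word [0] (map (Fun \<circ> code_fun) [Finish, Head (start M), Start])"

lemma main_expr_type: "has_type G main_expr [0] [0]"
  unfolding main_expr_def by (rule comp_word_type) (auto simp: alphabet)

lemma typed_input_stacks:
  assumes "w \<in> lists (input_alphabet M)"
  shows "typed_stacks (input_stacks M w)"
  using typed_output_stacks[OF assms] alphabet
  by (auto simp: typed_stacks_def output_stacks_def input_stacks_def stack_word_def)

lemma word_main:
  assumes "w \<in> lists (input_alphabet M)"
  shows "comp1 G (parallel P [word w]) (path2_of G main_expr) = stack_path (input_stacks M w)"
proof -
  let ?c = "comp_word [] (stack_word (output_stacks w))"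
  have chain: "chain G [] (stack_word (output_stacks w)) [0]"
    using typed_output_stacks[OF assms] by (simp add: typed_stacks_def)
  have linear: "\<forall>c\<in>set (stack_word (output_stacks w)). linear c"
    using linear_chain[OF chain set_stack_word] .
  have type: "has_type G (?c \<star>\<^sub>1 main_expr) [] [0]"
    using comp_word_typed[OF chain] main_expr_type by (auto simp: has_type_iff)
  have "trace ?c [] = [stack_word (output_stacks w)]"
    using trace_comp_word[OF linear] by (simp add: stack_word_def output_stacks_def)
  then have "trace (?c \<star>\<^sub>1 main_expr) [] = [stack_word (input_stacks M w)]"
    by (simp add: main_expr_def stack_word_def output_stacks_def input_stacks_def)
  moreover have "set (cells_of (?c \<star>\<^sub>1 main_expr)) \<subseteq> range Constr \<union> range Fun"
    using set_stack_word by (auto simp: main_expr_def)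
  ultimately have "?c \<star>\<^sub>1 main_expr \<approx> comp_word [] (stack_word (input_stacks M w))"
    using eqv_comp_word(1)[OF type] by blast
  moreover have "comp1 G (parallel P [word w]) (path2_of G main_expr) = path2_of G (?c \<star>\<^sub>1 main_expr)"
    using comp1_path2_of[of ?c main_expr] type parallel_word[OF assms] word_eq_stack_path[OF assms]
    by (simp add: has_type_iff stack_path_def)
  ultimately show ?thesis using path2_of_eqI by (simp add: stack_path_def)
qed

primrec word_term :: "'a list \<Rightarrow> nat constr_term" where
  "word_term [] = Term empty_word []"
| "word_term (a # w) = Term (letter a) [word_term w]"

lemma term_expr_word_term:
  "w \<in> lists (input_alphabet M) \<Longrightarrow> term_expr (word_term w) \<approx> word_expr empty_word letter w"
proof (induction w)
  case Nil
  show ?case using eqv_unit1_left[of "Cell (Constr empty_word)" "[]"] by simp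
next
  case (Cons a w)
  then have IH: "term_expr (word_term w) \<approx> word_expr empty_word letter w"
    and a: "a \<in> input_alphabet M" and w: "w \<in> lists (input_alphabet M)" by auto
  have wt: "well_typed (term_expr (word_term w))" "cod1 (term_expr (word_term w)) = [0]"
    using same_path_typed[OF IH] word_expr_type[OF w] by (auto simp: has_type_iff)
  have "(term_expr (word_term w) \<star>\<^sub>0 Path []) \<star>\<^sub>1 Cell (Constr (letter a)) \<approx>
      word_expr empty_word letter w \<star>\<^sub>1 Cell (Constr (letter a))"
    by (rule eqv_cong1[OF same_path.trans[OF eqv_unit0_right[OF wt(1)] IH] eqv_refl])
      (use a wt in auto)
  then show ?case by simp
qed

text \<open>As the normal form is unique, maximality amounts to reflexivity; what has to be shown is
  that a word denotes a constructor term.\<close>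

lemma val_le_word:
  assumes "w \<in> lists (input_alphabet M)"
  shows "val_le P (parallel P [word w]) (parallel P [word w])"
proof -
  note t = term_expr_word_term[OF assms]
  have wt: "well_typed (term_expr (word_term w))" using same_path_typed[OF t] by simp
  have "parallel P [word w] = path2_of G (term_expr (word_term w) \<star>\<^sub>0 Path [])"
    using path2_of_eqI[OF same_path.trans[OF eqv_unit0_right[OF wt] t]] parallel_word[OF assms]
    by (simp add: word_val_def)
  moreover have "has_type G (term_expr (word_term w) \<star>\<^sub>0 Path []) [] [0]"
    using same_path_typed[OF t] word_expr_type[OF assms] by (auto simp: has_type_iff)
  ultimately have "denotes_terms P (parallel P [word w]) [word_term w]"
    by (auto simp: denotes_terms_def Let_def)
  then show ?thesis unfolding val_le_def using lexordp_eq_refl by blast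
qed

lemma computes_P:
  assumes f: "tm_computes M f"
    and g: "\<And>w. w \<in> lists (input_alphabet M) \<Longrightarrow> g [word w] = map_option (\<lambda>v. [word v]) (f w)"
  shows "computes P [0] [0] (path2_of G main_expr) g"
  unfolding computes_def Let_def
proof (intro conjI ballI)
  show "path2_of G main_expr \<in> paths2 G [0] [0]"
    using main_expr_type by (auto simp: paths2_def)
  fix ts
  assume "ts \<in> val_families P [0]"
  then obtain t where t: "ts = [t]" "t \<in> vals P 0"
    by (auto simp: val_families_def list_all2_Cons2)
  obtain w where w: "w \<in> lists (input_alphabet M)" "ts = [word w]"
    using value_is_word[OF t(2)] t(1) by metis
  let ?X = "comp1 G (parallel P ts) (path2_of G main_expr)"
  have X: "?X = stack_path (input_stacks M w)" using word_main[OF w(1)] w(2) by simp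
  note nf = normal_form_of_stack_path[OF typed_input_stacks[OF w(1)]]
  have fw: "case f w of None \<Rightarrow> \<nexists>v. tm_halts_with M w v
      | Some v \<Rightarrow> v \<in> lists (input_alphabet M) \<and> tm_halts_with M w v"
    using f w(1) unfolding tm_computes_def by blast
  show "case g ts of None \<Rightarrow> \<nexists>Y. normal_form_of G ?X Y
      | Some us \<Rightarrow> us \<in> val_families P [0] \<and> normal_form_of G ?X (parallel P us) \<and>
          (\<not> confluentp (rewrite_step G) \<longrightarrow>
            (\<forall>Y. normal_form_of G ?X Y \<longrightarrow> val_le P Y (parallel P us)))"
  proof (cases "f w")
    case None
    then have "\<nexists>v. tm_halts_with M w v" using fw by simp
    then have "\<nexists>Y. normal_form_of G ?X Y"
      unfolding X nf using normal_form_halts[OF M w(1)] by blast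
    then show ?thesis using g[OF w(1)] None w(2) by simp
  next
    case (Some v)
    then have v: "v \<in> lists (input_alphabet M)" "tm_halts_with M w v"
      using fw by simp_all
    have steps: "(stack_step M)\<^sup>*\<^sup>* (input_stacks M w) (output_stacks v)"
      using halts_stack_steps[OF M w(1) v(2,1)] .
    \<comment> \<open>Any other normal form would lie on the same deterministic run and lead to
      \<open>output_stacks v\<close>, which is impossible without a further step.\<close>
    have unique: "c = output_stacks v"
      if "(stack_step M)\<^sup>*\<^sup>* (input_stacks M w) c" "\<nexists>c'. stack_step M c c'" for c
      using deterministic_rtranclp[OF right_unique_stack_step that(2) steps that(1)]
        output_stacks_normal by (metis converse_rtranclpE)
    have us: "parallel P [word v] = stack_path (output_stacks v)"
      using parallel_word word_eq_stack_path v(1) by simp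
    have "normal_form_of G ?X (parallel P [word v])"
      unfolding X nf us using steps output_stacks_normal by blast
    moreover have "val_le P Y (parallel P [word v])" if "normal_form_of G ?X Y" for Y
    proof -
      have "Y = parallel P [word v]"
        using that unique unfolding X nf us by blast
      then show ?thesis using val_le_word[OF v(1)] by simp
    qed
    moreover have "[word v] \<in> val_families P [0]"
      using word_value[OF v(1)] by (simp add: val_families_def)
    moreover have "g ts = Some [word v]" using g[OF w(1)] Some w(2) by simp
    ultimately show ?thesis by simp
  qed
qed

end

theorem theorem2p7:
  fixes M :: "('q, 'a) tm" and f :: "'a list \<Rightarrow> 'a list option"
  assumes "turing_machine M" and "tm_computes M f"
  shows "\<exists>(P :: (nat, nat, nat, nat) program) \<xi> e letter F g.
    polygraphic_program P \<and> finite_program P \<and>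
    word_sort P (input_alphabet M) \<xi> e letter \<and>
    computes P [\<xi>] [\<xi>] F g \<and>
    (\<forall>w\<in>lists (input_alphabet M).
       g [word_val P e letter w] = map_option (\<lambda>v. [word_val P e letter v]) (f w))"
proof -
  have "finite (states M)" "finite (tape_alphabet M)" "finite (input_alphabet M)"
    using assms(1) by (auto simp: turing_machine_def intro: finite_subset)
  then have "finite (tm_constrs M)" "finite (tm_funs M)"
    by (auto simp: tm_constrs_def tm_funs_def)
  then obtain code_constr :: "('q, 'a) tm_constr \<Rightarrow> nat" and code_fun :: "('q, 'a) tm_fun \<Rightarrow> nat"
    where "inj_on code_constr (tm_constrs M)" "inj_on code_fun (tm_funs M)"
    using finite_imp_inj_to_nat_seg[of "tm_constrs M"] finite_imp_inj_to_nat_seg[of "tm_funs M"] by blast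
  then interpret coded_tm M code_constr code_fun
    using assms(1) by (simp add: coded_tm_def)
  \<comment> \<open>The inverse decodes a representation of a word; by \<open>value_is_word\<close>
    every family of values for \<open>[0]\<close> is one, so arbitrary results elsewhere do no
    harm.\<close>
  define g where "g = (\<lambda>ts. map_option (\<lambda>v. [word v])
    (f (inv_into (lists (input_alphabet M)) (\<lambda>w. [word w]) ts)))"
  have g: "g [word w] = map_option (\<lambda>v. [word v]) (f w)" if "w \<in> lists (input_alphabet M)" for w
    using inv_into_f_f[OF inj_on_word that] by (simp add: g_def)
  show ?thesis
  proof (intro exI conjI ballI)
    show "computes P [0] [0] (path2_of G main_expr) g"
      by (rule computes_P[OF assms(2) g])
  qed (rule polygraphic_P finite_P word_sort_P g; assumption?)+
qed

end
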